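(* Let $0<n<d$ be integers and let $\Theta_n$ be a countably $\mathcal{H}^n$-rectifiable random closed set in $\mathbb{R}^d$ with Hausdorff dimension $n$ and locally finite $\mathcal{H}^n$-measure, given as a germ-grain model $$\Theta_n(\omega)=\bigcup_{(x_i,s_i)\in\Phi(\omega)}\bigl(x_i+Z(s_i)\bigr),$$ where $\Phi$ is a marked point process in $\mathbb{R}^d$ with marks in $\mathbf{K}$, with intensity measure $\Lambda(\mathrm{d}(x,s))=\lambda(x,s)\,\mathrm{d}x\,Q(\mathrm{d}s)$ and second factorial moment measure $\nu_{[2]}(\mathrm{d}(x,s,y,t))=g(x,s,y,t)\,\mathrm{d}x\,\mathrm{d}y\,Q_{[2]}(\mathrm{d}(s,t))$. Then the mean density $\lambda_{\Theta_n}$ of $\Theta_n$ is given by $$\lambda_{\Theta_n}(y)=\int_{\mathbf{K}}\int_{y-Z(s)}\lambda(x,s)\,\mathcal{H}^n(\mathrm{d}x)\,Q(\mathrm{d}s)\qquad\text{for }\mathcal{H}^d\text{-a.e. }y\in\mathbb{R}^d.$$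
   Context: Notation: $\mathcal{H}^k$ is the $k$-dimensional Hausdorff measure, $\mathrm{d}x=\mathcal{H}^d(\mathrm{d}x)$; $y-A=\{y-z:z\in A\}$. A closed set $A\subset\mathbb{R}^d$ is countably $\mathcal{H}^n$-rectifiable if there are countably many $n$-dimensional Lipschitz graphs $\Gamma_i\subset\mathbb{R}^d$ such that $A\setminus\bigcup_i\Gamma_i$ is $\mathcal{H}^n$-negligible. Random sets: a random closed set is a measurable map from a probability space $(\Omega,\mathfrak{F},\mathbb{P})$ into the closed subsets of $\mathbb{R}^d$ with the $\sigma$-algebra generated by the Fell topology; it satisfies a property if it does so $\mathbb{P}$-almost surely. Marked point processes: $\mathbf{K}$ is a complete separable metric space (mark space). A marked point process $\Phi=\{(x_i,s_i)\}$ is a point process on $\mathbb{R}^d\times\mathbf{K}$ whose unmarked projection $\widetilde{\Phi}(B)=\Phi(B\times\mathbf{K})$ is a (locally finite) simple point process in $\mathbb{R}^d$. For each $s\in\mathbf{K}$, $Z(s)$ is a closed subset of $\mathbb{R}^d$ containing the origin, depending measurably on $s$. The intensity measure is $\Lambda(B\times L)=\mathbb{E}[\Phi(B\times L)]$; here $\lambda:\mathbb{R}^d\times\mathbf{K}\to[0,\infty)$ is measurable and $Q$ is a probability measure on $\mathbf{K}$. The second factorial moment measure $\nu_{[2]}$ on $(\mathbb{R}^d\times\mathbf{K})^2$ is defined by $\int f\,\mathrm{d}\nu_{[2]}=\mathbb{E}\bigl[\sum_{(x_i,s_i),(x_j,s_j)\in\Phi,\,x_i\ne x_j}f(x_i,s_i,x_j,s_j)\bigr]$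 for all non-negative measurable $f$; here $g:(\mathbb{R}^d\times\mathbf{K})^2\to[0,\infty)$ is measurable and $Q_{[2]}$ is a probability measure on $\mathbf{K}^2$. Mean density: $\mathbb{E}[\mu_{\Theta_n}](A):=\mathbb{E}[\mathcal{H}^n(\Theta_n\cap A)]$ for Borel $A\subset\mathbb{R}^d$; the mean density $\lambda_{\Theta_n}$ is the density of $\mathbb{E}[\mu_{\Theta_n}]$ with respect to $\mathcal{H}^d$, i.e. $\mathbb{E}[\mu_{\Theta_n}](A)=\int_A\lambda_{\Theta_n}(y)\,\mathrm{d}y$ for all Borel $A$.
   Formalization: Added assumption: for Q-a.e. mark s with λ(·,s)=0 H^d-a.e. (marks that a.s. never occur in Φ), Z(s) has locally finite H^n-measure; without it the formula can fail, as λ(·,s) may be positive on an H^d-null set that the integral over y−Z(s) sees. *)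

theory Defs
  imports "HOL-Probability.Probability"
begin

section \<open>Hausdorff measure\<close>

text \<open>Gauge of order \<open>s\<close> of a covering set. The factor \<^const>\<open>unit_ball_vol\<close> is the usual normalisation,
  for which the Hausdorff measure of order \<open>DIM('a)\<close> is Lebesgue measure. The case \<open>s = 0\<close> is separate
  since \<open>0 powr 0 = 0\<close>, whereas singletons have to count 1 there.\<close>

definition hausdorff_gauge :: "real \<Rightarrow> 'a::metric_space set \<Rightarrow> ennreal" where
  "hausdorff_gauge s U =
     (if U = {} then 0
      else ennreal (unit_ball_vol s * (if s = 0 then 1 else (diameter U / 2) powr s)))"

text \<open>Boundedness is required explicitly because \<^const>\<open>diameter\<close> is unspecified on unbounded sets.\<close>

definition hausdorff_content :: "real \<Rightarrow> real \<Rightarrow> 'a::metric_space set \<Rightarrow> ennreal" where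
  "hausdorff_content \<delta> s A =
     (INF C\<in>{C :: nat \<Rightarrow> 'a set. A \<subseteq> (\<Union>i. C i) \<and> (\<forall>i. bounded (C i) \<and> diameter (C i) \<le> \<delta>)}.
        \<Sum>i. hausdorff_gauge s (C i))"

definition hausdorff_outer :: "real \<Rightarrow> 'a::metric_space set \<Rightarrow> ennreal" where
  "hausdorff_outer s A = (SUP \<delta>\<in>{0<..}. hausdorff_content \<delta> s A)"

definition hausdorff_measure :: "real \<Rightarrow> 'a::metric_space measure" where
  "hausdorff_measure s = measure_of UNIV (sets borel) (hausdorff_outer s)"

abbreviation hausdorff_volume :: "'a::euclidean_space measure" where
  "hausdorff_volume \<equiv> hausdorff_measure DIM('a)"

definition hausdorff_dim :: "'a::metric_space set \<Rightarrow> real" where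
  "hausdorff_dim A = Inf {s. 0 \<le> s \<and> hausdorff_outer s A = 0}"

lemma sets_hausdorff_measure [simp, measurable_cong]: "sets (hausdorff_measure s) = sets borel"
  unfolding hausdorff_measure_def
  by (metis sets.sigma_sets_eq sets_measure_of space_borel top_greatest Pow_UNIV)

lemma space_hausdorff_measure [simp]: "space (hausdorff_measure s) = UNIV"
  unfolding hausdorff_measure_def by simp

text \<open>\<^const>\<open>measure_of\<close> silently returns the zero measure if the given set function is not countably
  additive. The following lemmas, up to \<open>emeasure_hausdorff_measure\<close>, show that this does not happen.\<close>

lemma hausdorff_gauge_mono:
  assumes "0 \<le> s" "U \<subseteq> V" "bounded V"
  shows "hausdorff_gauge s U \<le> hausdorff_gauge s V"
proof (cases "U = {}")
  case False
  have "0 \<le> diameter U" "diameter U \<le> diameter V"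
    using assms by (auto intro: diameter_ge_0 diameter_subset bounded_subset)
  then have "(diameter U / 2) powr s \<le> (diameter V / 2) powr s"
    using assms(1) by (intro powr_mono2) auto
  moreover have "0 \<le> unit_ball_vol s"
    using assms(1) by (simp add: unit_ball_vol_nonneg)
  moreover have "V \<noteq> {}"
    using False assms(2) by auto
  ultimately show ?thesis
    unfolding hausdorff_gauge_def by (auto intro!: ennreal_leI mult_left_mono)
qed (simp add: hausdorff_gauge_def)

lemma hausdorff_content_le:
  assumes "A \<subseteq> (\<Union>i. C i)" "\<And>i. bounded (C i)" "\<And>i. diameter (C i) \<le> \<delta>"
  shows "hausdorff_content \<delta> s A \<le> (\<Sum>i. hausdorff_gauge s (C i))"
  unfolding hausdorff_content_def using assms by (intro INF_lower) auto

lemma hausdorff_content_empty: "0 < \<delta> \<Longrightarrow> hausdorff_content \<delta> s {} = 0"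
  using hausdorff_content_le[of "{}" "\<lambda>_. {}" \<delta> s] by (simp add: hausdorff_gauge_def)

lemma hausdorff_content_mono: "A \<subseteq> B \<Longrightarrow> hausdorff_content \<delta> s A \<le> hausdorff_content \<delta> s B"
  unfolding hausdorff_content_def by (rule INF_superset_mono) auto

lemma hausdorff_content_antimono: "\<delta> \<le> \<epsilon> \<Longrightarrow> hausdorff_content \<epsilon> s A \<le> hausdorff_content \<delta> s A"
  unfolding hausdorff_content_def by (rule INF_superset_mono) (auto intro: order_trans)

lemma hausdorff_content_UN:
  "hausdorff_content \<delta> s (\<Union>i::nat. A i) \<le> (\<Sum>i. hausdorff_content \<delta> s (A i))"
proof (rule ennreal_le_epsilon)
  fix e :: real
  assume "0 < e" "(\<Sum>n. hausdorff_content \<delta> s (A n)) < top"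
  then have *: "hausdorff_content \<delta> s (A n) < hausdorff_content \<delta> s (A n) + e * (1/2)^Suc n" for n
    by (auto simp add: less_top dest!: ennreal_suminf_lessD)
  have "\<exists>C. A n \<subseteq> (\<Union>i. C i) \<and> (\<forall>i. bounded (C i) \<and> diameter (C i) \<le> \<delta>) \<and>
      (\<Sum>i. hausdorff_gauge s (C i)) \<le> hausdorff_content \<delta> s (A n) + e * (1/2)^Suc n" for n
    using *[of n] unfolding hausdorff_content_def[of _ _ "A n"] INF_less_iff
    by (auto intro: less_imp_le)
  then obtain B where B: "\<And>n. A n \<subseteq> (\<Union>i. B n i)"
      "\<And>n i. bounded (B n i)" "\<And>n i. diameter (B n i) \<le> \<delta>"
      "\<And>n. (\<Sum>i. hausdorff_gauge s (B n i)) \<le> hausdorff_content \<delta> s (A n) + e * (1/2)^Suc n"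
    by metis
  define C where "C = case_prod B \<circ> prod_decode"
  have "(\<Union>i. A i) \<subseteq> (\<Union>i. C i)"
    using B(1) by (auto simp add: C_def subset_eq) (metis prod.case prod_encode_inverse)
  then have "hausdorff_content \<delta> s (\<Union>i. A i) \<le> (\<Sum>i. hausdorff_gauge s (C i))"
    using B by (intro hausdorff_content_le) (auto simp: C_def split: prod.split)
  also have "\<dots> = (\<Sum>n. \<Sum>i. hausdorff_gauge s (B n i))"
    unfolding C_def comp_def
    using suminf_ennreal_2dimen[of "\<lambda>n. \<Sum>i. hausdorff_gauge s (B n i)"
        "\<lambda>p. hausdorff_gauge s (case_prod B p)"] by simp
  also have "\<dots> \<le> (\<Sum>n. hausdorff_content \<delta> s (A n) + e * (1/2) ^ Suc n)"
    by (intro suminf_le allI B) auto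
  also have "\<dots> = (\<Sum>n. hausdorff_content \<delta> s (A n)) + (\<Sum>n. ennreal e * ennreal ((1/2) ^ Suc n))"
    using \<open>0 < e\<close> by (subst suminf_add[symmetric])
      (auto simp del: ennreal_suminf_cmult simp add: ennreal_mult[symmetric])
  also have "\<dots> = (\<Sum>n. hausdorff_content \<delta> s (A n)) + e"
    unfolding ennreal_suminf_cmult
    by (subst suminf_ennreal_eq[OF zero_le_power power_half_series]) auto
  finally show "hausdorff_content \<delta> s (\<Union>i. A i) \<le> (\<Sum>n. hausdorff_content \<delta> s (A n)) + e" .
qed

lemma hausdorff_outer_empty: "hausdorff_outer s {} = 0"
  unfolding hausdorff_outer_def by (simp add: hausdorff_content_empty)

lemma hausdorff_outer_mono: "A \<subseteq> B \<Longrightarrow> hausdorff_outer s A \<le> hausdorff_outer s B"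
  unfolding hausdorff_outer_def by (intro SUP_mono) (auto intro: hausdorff_content_mono)

lemma hausdorff_outer_UN:
  "hausdorff_outer s (\<Union>i::nat. A i) \<le> (\<Sum>i. hausdorff_outer s (A i))"
  unfolding hausdorff_outer_def[of s "\<Union>i. A i"]
proof (rule SUP_least)
  fix \<delta> :: real
  assume "\<delta> \<in> {0<..}"
  then have "(\<Sum>i. hausdorff_content \<delta> s (A i)) \<le> (\<Sum>i. hausdorff_outer s (A i))"
    unfolding hausdorff_outer_def by (intro suminf_le SUP_upper) auto
  with hausdorff_content_UN[of \<delta> s A]
  show "hausdorff_content \<delta> s (\<Union>i. A i) \<le> (\<Sum>i. hausdorff_outer s (A i))"
    by (rule order_trans)
qed

lemma outer_measure_space_hausdorff: "outer_measure_space UNIV (hausdorff_outer s)"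
  unfolding outer_measure_space_def positive_def increasing_def countably_subadditive_def
  by (auto simp: hausdorff_outer_empty hausdorff_outer_mono hausdorff_outer_UN)

lemma hausdorff_outer_Un: "hausdorff_outer s (A \<union> B) \<le> hausdorff_outer s A + hausdorff_outer s B"
proof -
  have "A \<union> B = (\<Union>i::nat. binaryset A B i)"
    by (simp add: UN_binaryset_eq)
  then show ?thesis
    using hausdorff_outer_UN[of s "binaryset A B"]
      suminf_binaryset_eq[of "hausdorff_outer s" A B] hausdorff_outer_empty by metis
qed

lemma hausdorff_outer_separated:
  assumes "0 \<le> s" "0 < e" and sep: "\<And>x y. x \<in> A \<Longrightarrow> y \<in> B \<Longrightarrow> e \<le> dist x y"
  shows "hausdorff_outer s A + hausdorff_outer s B \<le> hausdorff_outer s (A \<union> B)"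
proof -
  have small: "hausdorff_content \<delta> s A + hausdorff_content \<delta> s B \<le> hausdorff_outer s (A \<union> B)"
    if \<delta>: "0 < \<delta>" "\<delta> < e" for \<delta>
  proof -
    have "hausdorff_content \<delta> s A + hausdorff_content \<delta> s B \<le> hausdorff_content \<delta> s (A \<union> B)"
      unfolding hausdorff_content_def[of \<delta> s "A \<union> B"]
    proof (rule INF_greatest, clarify)
      fix C :: "nat \<Rightarrow> 'a set"
      assume cov: "A \<union> B \<subseteq> (\<Union>i. C i)" and C: "\<forall>i. bounded (C i) \<and> diameter (C i) \<le> \<delta>"
      have part: "hausdorff_content \<delta> s X \<le> (\<Sum>i. hausdorff_gauge s (C i \<inter> X))"
        if "X \<subseteq> A \<union> B" for X
        using that cov C
        by (intro hausdorff_content_le) (auto intro: order_trans[OF diameter_subset])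
      have "C i \<inter> A = {} \<or> C i \<inter> B = {}" for i
      proof (rule ccontr)
        assume "\<not> ?thesis"
        then obtain x y where "x \<in> C i \<inter> A" "y \<in> C i \<inter> B"
          by blast
        then have "e \<le> dist x y" "dist x y \<le> diameter (C i)"
          using sep C by (auto intro: diameter_bounded_bound)
        with C \<delta> show False
          by (meson linorder_not_less order_trans)
      qed
      then have split: "hausdorff_gauge s (C i \<inter> A) + hausdorff_gauge s (C i \<inter> B) \<le> hausdorff_gauge s (C i)"
        for i
        using hausdorff_gauge_mono[OF assms(1), of "C i \<inter> A" "C i"]
          hausdorff_gauge_mono[OF assms(1), of "C i \<inter> B" "C i"] C
        by (metis Int_lower1 add.left_neutral add.right_neutral hausdorff_gauge_def)
      have "hausdorff_content \<delta> s A + hausdorff_content \<delta> s B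
          \<le> (\<Sum>i. hausdorff_gauge s (C i \<inter> A)) + (\<Sum>i. hausdorff_gauge s (C i \<inter> B))"
        by (intro add_mono part) auto
      also have "\<dots> = (\<Sum>i. hausdorff_gauge s (C i \<inter> A) + hausdorff_gauge s (C i \<inter> B))"
        by (intro suminf_add) auto
      also have "\<dots> \<le> (\<Sum>i. hausdorff_gauge s (C i))"
        using split by (intro suminf_le) auto
      finally show "hausdorff_content \<delta> s A + hausdorff_content \<delta> s B
          \<le> (\<Sum>i. hausdorff_gauge s (C i))" .
    qed
    also have "\<dots> \<le> hausdorff_outer s (A \<union> B)"
      unfolding hausdorff_outer_def using \<delta> by (intro SUP_upper) auto
    finally show ?thesis .
  qed
  have all: "hausdorff_content \<delta> s A + hausdorff_content \<epsilon> s B \<le> hausdorff_outer s (A \<union> B)"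
    if "0 < \<delta>" "0 < \<epsilon>" for \<delta> \<epsilon>
  proof -
    define r where "r = min (min \<delta> \<epsilon>) (e / 2)"
    have "0 < r" "r < e" "r \<le> \<delta>" "r \<le> \<epsilon>"
      using that \<open>0 < e\<close> by (auto simp: r_def)
    then show ?thesis
      using small[of r] add_mono[OF hausdorff_content_antimono hausdorff_content_antimono]
      by (meson order_trans)
  qed
  have "hausdorff_content \<delta> s A + hausdorff_outer s B \<le> hausdorff_outer s (A \<union> B)" if "0 < \<delta>" for \<delta>
  proof -
    have "hausdorff_content \<delta> s A + hausdorff_outer s B
        = (SUP \<epsilon>\<in>{0<..}. hausdorff_content \<delta> s A + hausdorff_content \<epsilon> s B)"
      unfolding hausdorff_outer_def by (rule ennreal_SUP_add_right) simp
    also have "\<dots> \<le> hausdorff_outer s (A \<union> B)"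
      using all that by (intro SUP_least) auto
    finally show ?thesis .
  qed
  then have "(SUP \<delta>\<in>{0<..}. hausdorff_content \<delta> s A + hausdorff_outer s B) \<le> hausdorff_outer s (A \<union> B)"
    by (intro SUP_least) auto
  then show ?thesis
    unfolding hausdorff_outer_def[of s A] by (subst (asm) ennreal_SUP_add_left) simp_all
qed

lemma hausdorff_outer_annuli:
  fixes d :: "'a::metric_space \<Rightarrow> real"
  assumes "0 \<le> s" and lip: "\<And>x y. \<bar>d x - d y\<bar> \<le> dist x y"
    and R: "\<And>k. R k = {x \<in> A. 1 / real (k + 2) \<le> d x \<and> d x < 1 / real (k + 1)}"
  shows "(\<Sum>k<n. hausdorff_outer s (R (2 * k + j))) \<le> hausdorff_outer s A"
proof -
  have "(\<Sum>k<n. hausdorff_outer s (R (2 * k + j))) \<le> hausdorff_outer s (\<Union>k<n. R (2 * k + j))"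
  proof (induction n)
    case (Suc n)
    note IH = Suc.IH
    define a where "a = 2 * n + j"
    show ?case
    proof (cases n)
      case 0
      then show ?thesis by (simp add: lessThan_Suc)
    next
      case (Suc m)
      define e where "e = 1 / real a - 1 / real (a + 1)"
      have "0 < a" using Suc by (simp add: a_def)
      then have "0 < e"
        unfolding e_def by (simp add: frac_less2)
      moreover have "e \<le> dist x y" if x: "x \<in> (\<Union>k<n. R (2 * k + j))" and y: "y \<in> R a" for x y
      proof -
        from x obtain k where k: "k < n" "x \<in> R (2 * k + j)" by blast
        have "1 / real a \<le> 1 / real (2 * k + j + 2)"
          using k \<open>0 < a\<close> by (intro divide_left_mono) (auto simp: a_def)
        also have "\<dots> \<le> d x"
          using k R by auto
        finally have "e \<le> d x - d y"
          using y R unfolding e_def by auto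
        with lip[of x y] show ?thesis by linarith
      qed
      ultimately have "hausdorff_outer s (\<Union>k<n. R (2 * k + j)) + hausdorff_outer s (R a)
          \<le> hausdorff_outer s ((\<Union>k<n. R (2 * k + j)) \<union> R a)"
        by (rule hausdorff_outer_separated[OF assms(1)])
      with IH have "(\<Sum>k<n. hausdorff_outer s (R (2 * k + j))) + hausdorff_outer s (R a)
          \<le> hausdorff_outer s ((\<Union>k<n. R (2 * k + j)) \<union> R a)"
        by (meson add_right_mono order_trans)
      moreover have "(\<Union>k<Suc n. R (2 * k + j)) = (\<Union>k<n. R (2 * k + j)) \<union> R a"
        by (auto simp: a_def less_Suc_eq)
      ultimately show ?thesis
        by (simp only: sum.lessThan_Suc a_def)
    qed
  qed (simp add: hausdorff_outer_empty)
  also have "\<dots> \<le> hausdorff_outer s A"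
    by (rule hausdorff_outer_mono) (auto simp: R)
  finally show ?thesis .
qed

lemma closed_hausdorff_caratheodory:
  fixes F :: "'a::metric_space set"
  assumes "0 \<le> s" "closed F"
  shows "hausdorff_outer s (A \<inter> F) + hausdorff_outer s (A - F) = hausdorff_outer s A"
proof (rule antisym)
  let ?H = "hausdorff_outer s :: 'a set \<Rightarrow> ennreal"
  show "?H A \<le> ?H (A \<inter> F) + ?H (A - F)"
    using hausdorff_outer_Un[of s "A \<inter> F" "A - F"] by (simp add: Int_Diff_Un)
  show "?H (A \<inter> F) + ?H (A - F) \<le> ?H A"
  proof (cases "F = {} \<or> ?H A = top")
    case True
    then show ?thesis by (auto simp: hausdorff_outer_empty)
  next
    case False
    define d where "d x = infdist x F" for x
    define R where "R k = {x \<in> A. 1 / real (k + 2) \<le> d x \<and> d x < 1 / real (k + 1)}" for k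
    define G where "G n = {x \<in> A. 1 / real (n + 1) \<le> d x}" for n
    define c where "c = (\<Sum>k. ?H (R k))"
    have lip: "\<bar>d x - d y\<bar> \<le> dist x y" for x y
      using infdist_triangle[of x F y] infdist_triangle[of y F x]
      unfolding d_def by (simp add: dist_commute)
    have part: "?H (A \<inter> F) + ?H (G n) \<le> ?H A" for n
    proof -
      have "?H (A \<inter> F) + ?H (G n) \<le> ?H ((A \<inter> F) \<union> G n)"
      proof (rule hausdorff_outer_separated[OF assms(1), of "1 / real (n + 1)"])
        fix x y
        assume "x \<in> A \<inter> F" "y \<in> G n"
        then have "d x = 0" "1 / real (n + 1) \<le> d y"
          by (auto simp: d_def G_def)
        with lip[of x y] show "1 / real (n + 1) \<le> dist x y" by linarith
      qed simp
      also have "\<dots> \<le> ?H A"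
        by (rule hausdorff_outer_mono) (auto simp: G_def)
      finally show ?thesis .
    qed
    have c_le: "c \<le> ?H A + ?H A"
      unfolding c_def
    proof (rule suminf_le_const[OF summableI])
      fix n
      have "(\<Sum>k<n. ?H (R k)) \<le> (\<Sum>k<2 * n. ?H (R k))"
        by (rule sum_mono2) auto
      also have "\<dots> = (\<Sum>k<n. ?H (R (2 * k + 0))) + (\<Sum>k<n. ?H (R (2 * k + 1)))"
        by (induction n) (auto simp: algebra_simps)
      also have "\<dots> \<le> ?H A + ?H A"
        by (intro add_mono hausdorff_outer_annuli[OF assms(1) lip R_def])
      finally show "(\<Sum>k<n. ?H (R k)) \<le> ?H A + ?H A" .
    qed
    have cover: "A - F \<subseteq> G n \<union> (\<Union>k. R (k + n))" for n
    proof
      fix x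
      assume x: "x \<in> A - F"
      then have "0 < d x"
        unfolding d_def using False assms(2)
        by (metis DiffD2 in_closed_iff_infdist_zero infdist_nonneg order_le_less)
      then obtain N where N: "1 / real (N + 1) \<le> d x"
        by (metis add.commute less_imp_le inverse_eq_divide reals_Archimedean Suc_eq_plus1_left)
      define m where "m = (LEAST m. 1 / real (m + 1) \<le> d x)"
      have m: "1 / real (m + 1) \<le> d x"
        unfolding m_def using N by (rule LeastI)
      have m_least: "d x < 1 / real (i + 1)" if "i < m" for i
        using that not_less_Least unfolding m_def by (meson not_le)
      show "x \<in> G n \<union> (\<Union>k. R (k + n))"
      proof (cases "m \<le> n")
        case True
        then have "1 / real (n + 1) \<le> 1 / real (m + 1)"
          by (intro divide_left_mono) auto
        with m x show ?thesis by (auto simp: G_def)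
      next
        case False
        then obtain i where i: "m = Suc (i + n)"
          by (metis add.commute less_imp_Suc_add not_le)
        then have "x \<in> R (i + n)"
          using m m_least[of "i + n"] x by (simp add: R_def algebra_simps)
        then show ?thesis by blast
      qed
    qed
    have "c + (?H (A \<inter> F) + ?H (A - F)) \<le> ?H A + c"
      unfolding c_def
    proof (rule ennreal_suminf_bound_add)
      fix n
      have "?H (A - F) \<le> ?H (G n) + (\<Sum>k. ?H (R (k + n)))"
        using hausdorff_outer_mono[OF cover[of n], of s]
          hausdorff_outer_Un[of s "G n" "\<Union>k. R (k + n)"]
          add_left_mono[OF hausdorff_outer_UN[of s "\<lambda>k. R (k + n)"], of "?H (G n)"]
        by (meson order_trans)
      then have "(\<Sum>k<n. ?H (R k)) + (?H (A \<inter> F) + ?H (A - F))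
          \<le> (?H (A \<inter> F) + ?H (G n)) + ((\<Sum>k. ?H (R (k + n))) + (\<Sum>k<n. ?H (R k)))"
        by (simp add: algebra_simps add_left_mono add_right_mono)
      also have "(\<Sum>k. ?H (R (k + n))) + (\<Sum>k<n. ?H (R k)) = (\<Sum>k. ?H (R k))"
        by (rule suminf_offset[symmetric, OF summableI])
      also have "(?H (A \<inter> F) + ?H (G n)) + (\<Sum>k. ?H (R k)) \<le> ?H A + (\<Sum>k. ?H (R k))"
        by (intro add_right_mono part)
      finally show "(\<Sum>k<n. ?H (R k)) + (?H (A \<inter> F) + ?H (A - F)) \<le> ?H A + (\<Sum>k. ?H (R k))" .
    qed
    moreover have "c \<noteq> top"
      using c_le False by (auto simp: top_unique)
    ultimately show ?thesis
      by (simp add: add.commute[of _ c] ennreal_add_left_cancel_le)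
  qed
qed

lemma measure_space_hausdorff:
  assumes "0 \<le> s"
  shows "measure_space UNIV (sets borel) (hausdorff_outer s :: 'a::metric_space set \<Rightarrow> ennreal)"
proof -
  let ?L = "lambda_system UNIV UNIV (hausdorff_outer s :: 'a set \<Rightarrow> ennreal)"
  interpret P: sigma_algebra UNIV "UNIV :: 'a set set"
    using sigma_algebra_Pow[of "UNIV :: 'a set"] by simp
  have L: "measure_space UNIV ?L (hausdorff_outer s)"
    by (rule P.caratheodory_lemma[OF outer_measure_space_hausdorff])
  then have sa: "sigma_algebra UNIV ?L"
    by (simp add: measure_space_def)
  have "sets (borel :: 'a measure) = sigma_sets UNIV (Collect closed)"
    by (simp add: borel_eq_closed)
  also have "\<dots> \<subseteq> ?L"
    using closed_hausdorff_caratheodory[OF assms]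
    by (intro sigma_algebra.sigma_sets_subset[OF sa]) (auto simp: P.lambda_system_eq)
  finally show ?thesis
    by (intro measure_down[OF L]) (auto intro: sets.sigma_algebra_axioms[of borel, simplified])
qed

lemma emeasure_hausdorff_measure:
  assumes "0 \<le> s" "A \<in> sets borel"
  shows "emeasure (hausdorff_measure s) A = hausdorff_outer s A"
proof (rule emeasure_measure_of[OF hausdorff_measure_def])
  have "measure_space UNIV (sets borel) (hausdorff_outer s :: 'a set \<Rightarrow> ennreal)"
    by (rule measure_space_hausdorff[OF assms(1)])
  then show "positive (sets (hausdorff_measure s)) (hausdorff_outer s :: 'a set \<Rightarrow> ennreal)"
    "countably_additive (sets (hausdorff_measure s)) (hausdorff_outer s :: 'a set \<Rightarrow> ennreal)"
    by (simp_all add: measure_space_def)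
qed (use assms in simp_all)


section \<open>Rectifiable closed sets\<close>

definition lipschitz_graph :: "nat \<Rightarrow> 'a::euclidean_space set \<Rightarrow> bool" where
  "lipschitz_graph n \<Gamma> \<longleftrightarrow>
     (\<exists>V f L. subspace V \<and> dim V = n \<and> L-lipschitz_on V f \<and> f ` V \<subseteq> V\<^sup>\<bottom> \<and>
        \<Gamma> = (\<lambda>v. v + f v) ` V)"

definition countably_rectifiable :: "nat \<Rightarrow> 'a::euclidean_space set \<Rightarrow> bool" where
  "countably_rectifiable n A \<longleftrightarrow> closed A \<and>
     (\<exists>\<Gamma> :: nat \<Rightarrow> 'a set. (\<forall>i. lipschitz_graph n (\<Gamma> i)) \<and> hausdorff_outer n (A - (\<Union>i. \<Gamma> i)) = 0)"

definition locally_finite_hausdorff :: "nat \<Rightarrow> 'a::euclidean_space set \<Rightarrow> bool" where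
  "locally_finite_hausdorff n A \<longleftrightarrow>
     (\<forall>K. compact K \<longrightarrow> emeasure (hausdorff_measure n) (A \<inter> K) < \<infinity>)"


section \<open>Random closed sets\<close>

definition fell_topology :: "'a::topological_space set topology" where
  "fell_topology = topology_generated_by
     ({{F. closed F \<and> F \<inter> K = {}} |K. compact K} \<union> {{F. closed F \<and> F \<inter> G \<noteq> {}} |G. open G})"

definition fell_borel :: "'a::topological_space set measure" where
  "fell_borel = sigma {F. closed F} {\<F>. openin fell_topology \<F>}"

lemma topspace_fell_topology: "topspace fell_topology = {F. closed F}"
proof -
  have "{F. closed F} \<in> {{F. closed F \<and> F \<inter> K = {}} |K. compact K}"
    by (rule CollectI, rule exI[of _ "{}"]) simp
  then show ?thesis
    unfolding fell_topology_def topology_generated_by_topspace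
    by (intro antisym Sup_upper UnI1 Union_least) auto
qed

lemma space_fell_borel: "space fell_borel = {F. closed F}"
  unfolding fell_borel_def
  by (rule space_measure_of) (use openin_subset topspace_fell_topology in blast)


section \<open>Marked point processes\<close>

text \<open>A realisation is the set of its marked points. No multiplicities are lost, since the points in
  \<open>'a\<close> of a realisation are almost surely distinct.\<close>

definition marked_point_process ::
    "'w measure \<Rightarrow> ('w \<Rightarrow> ('a::euclidean_space \<times> 'k::polish_space) set) \<Rightarrow> bool" where
  "marked_point_process M \<Phi> \<longleftrightarrow>
     (\<forall>\<omega>\<in>space M. \<forall>B. bounded B \<longrightarrow> finite (\<Phi> \<omega> \<inter> B \<times> UNIV)) \<and>
     (AE \<omega> in M. inj_on fst (\<Phi> \<omega>)) \<and>
     (\<forall>C\<in>sets borel. (\<lambda>\<omega>. emeasure (count_space UNIV) (\<Phi> \<omega> \<inter> C)) \<in> borel_measurable M)"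

definition is_intensity_measure ::
    "'w measure \<Rightarrow> ('w \<Rightarrow> ('a::euclidean_space \<times> 'k::polish_space) set) \<Rightarrow> ('a \<times> 'k) measure \<Rightarrow> bool"
  where
  "is_intensity_measure M \<Phi> \<Lambda> \<longleftrightarrow> sets \<Lambda> = sets borel \<and>
     (\<forall>C\<in>sets borel. emeasure \<Lambda> C = (\<integral>\<^sup>+\<omega>. emeasure (count_space UNIV) (\<Phi> \<omega> \<inter> C) \<partial>M))"

definition is_second_factorial_moment_measure ::
    "'w measure \<Rightarrow> ('w \<Rightarrow> ('a::euclidean_space \<times> 'k::polish_space) set) \<Rightarrow>
      (('a \<times> 'k) \<times> ('a \<times> 'k)) measure \<Rightarrow> bool" where
  "is_second_factorial_moment_measure M \<Phi> \<nu> \<longleftrightarrow> sets \<nu> = sets borel \<and>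
     (\<forall>f :: _ \<Rightarrow> ennreal. f \<in> borel_measurable borel \<longrightarrow>
        (\<integral>\<^sup>+z. f z \<partial>\<nu>) =
        (\<integral>\<^sup>+\<omega>. (\<integral>\<^sup>+z. f z \<partial>count_space {(p, q). p \<in> \<Phi> \<omega> \<and> q \<in> \<Phi> \<omega> \<and> fst p \<noteq> fst q}) \<partial>M))"


section \<open>Mean density\<close>

definition is_mean_density ::
    "'w measure \<Rightarrow> nat \<Rightarrow> ('w \<Rightarrow> 'a::euclidean_space set) \<Rightarrow> ('a \<Rightarrow> ennreal) \<Rightarrow> bool" where
  "is_mean_density M n \<Theta> l \<longleftrightarrow> l \<in> borel_measurable borel \<and>
     (\<forall>A\<in>sets borel. (\<integral>\<^sup>+\<omega>. emeasure (hausdorff_measure n) (\<Theta> \<omega> \<inter> A) \<partial>M) =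
        (\<integral>\<^sup>+y\<in>A. l y \<partial>hausdorff_volume))"

end

theory Submission
  imports Defs
begin

text \<open>Almost surely \<open>\<Theta>\<close> is the union of the translated grains \<open>x + Z s\<close>, a countable union, so its
\<open>\<H>\<^sup>n\<close>-measure inside \<open>A\<close> is the sum of the measures of the pieces \<open>(x + Z s) \<inter> A\<close> as soon as distinct
grains overlap in \<open>\<H>\<^sup>n\<close>-null sets. Campbell's formula for the intensity measure and Fubini then turn the
expectation of this sum into
\[ \int_K \int_{Z(s)} \int_{R^d} \lambda(x,s)\, 1_A(x+u)\, dx\, H^n(du)\, Q(ds)
   = \int_A \int_K \int_{Z(s)} \lambda(y-u,s)\, H^n(du)\, Q(ds)\, dy, \]
and the reflection \<open>u \<mapsto> y - u\<close> turns the inner integral into the one over \<open>y - Z s\<close>.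

The overlaps are null because the second factorial moment measure has a density in the two positions: for
fixed \<open>x\<close>, \<open>s\<close>, \<open>t\<close>, Fubini gives
\[ \int_{R^d} H^n((x+Z(s)) \cap (y+Z(t)))\, dy = \int_{Z(s)} H^d(x+u-Z(t))\, H^n(du) = 0, \]
since a set of locally finite \<open>\<H>\<^sup>n\<close>-measure is \<open>\<H>\<^sup>d\<close>-null for \<open>n < d\<close>
(\<open>hausdorff_outer_null_higher_order\<close>). This is \<open>overlap_integral_eq_0\<close>.

Two points need care. First, Fubini requires \<open>\<H>\<^sup>n\<close> on \<open>Z s\<close> to be \<open>\<sigma>\<close>-finite. A grain that occurs in
\<open>\<Theta>\<close> inherits local finiteness from \<open>\<Theta>\<close>, but there may be marks whose grains are not locally finite. Such
grains are replaced by the empty set throughout; this changes nothing almost surely for the marks of the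
process, nor for \<open>Q\<close>-almost every mark. Second, all integrands have to be jointly measurable in
positions and marks. The basis is that \<open>F \<mapsto> \<H>\<^sup>n(F \<inter> K)\<close> is measurable for the Fell topology when \<open>K\<close> is
compact (\<open>hausdorff_outer_compact_part_measurable\<close>); a monotone class argument
(\<open>nn_integral_kernel_measurable\<close>) extends this to all integrals against \<open>\<H>\<^sup>n\<close> on the grains. The same
argument, applied to counting measures, yields the measurability of sums over the point process.\<close>

section \<open>Geometry of Hausdorff measures\<close>

lemma diameter_leI:
  fixes S :: "'a::metric_space set"
  assumes "0 \<le> e" "\<And>x y. x \<in> S \<Longrightarrow> y \<in> S \<Longrightarrow> dist x y \<le> e"
  shows "diameter S \<le> e"
  using assms by (auto simp: diameter_def intro: cSUP_least)

lemma hausdorff_gauge_diameter_mono: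
  assumes "0 \<le> s" "U = {} \<Longrightarrow> V = {}" "bounded V" "diameter V \<le> diameter U"
  shows "hausdorff_gauge s V \<le> hausdorff_gauge s U"
proof (cases "V = {}")
  case False
  have "0 \<le> diameter V"
    using assms(3) by (rule diameter_ge_0)
  then have "(diameter V / 2) powr s \<le> (diameter U / 2) powr s"
    using assms by (intro powr_mono2) auto
  moreover have "U \<noteq> {}"
    using False assms(2) by blast
  ultimately show ?thesis
    using False assms(1) unfolding hausdorff_gauge_def
    by (auto intro!: ennreal_leI mult_left_mono)
qed (simp add: hausdorff_gauge_def)

text \<open>A 1-Lipschitz map sends a cover to a cover by sets of no larger diameter. Isometry invariance follows by
applying this to the map and its inverse.\<close>

lemma hausdorff_outer_nonexpansive_image:
  fixes f :: "'a::metric_space \<Rightarrow> 'b::metric_space"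
  assumes "0 \<le> s" and f: "\<And>x y. dist (f x) (f y) \<le> dist x y"
  shows "hausdorff_outer s (f ` A) \<le> hausdorff_outer s A"
proof -
  have "hausdorff_content \<delta> s (f ` A) \<le> hausdorff_content \<delta> s A" for \<delta>
    unfolding hausdorff_content_def[of \<delta> s A]
  proof (rule INF_greatest, clarify)
    fix C :: "nat \<Rightarrow> 'a set"
    assume cov: "A \<subseteq> (\<Union>i. C i)" and C: "\<forall>i. bounded (C i) \<and> diameter (C i) \<le> \<delta>"
    have bd: "bounded (f ` C i)" for i
      using C f unfolding bounded_any_center bounded_def
      by (metis (no_types, lifting) imageE order_trans)
    have diam: "diameter (f ` C i) \<le> diameter (C i)" for i
    proof (rule diameter_leI)
      show "0 \<le> diameter (C i)"
        using C by (simp add: diameter_ge_0)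
      show "dist x y \<le> diameter (C i)" if "x \<in> f ` C i" "y \<in> f ` C i" for x y
        using that C by (auto intro!: order_trans[OF f] diameter_bounded_bound)
    qed
    have "f ` A \<subseteq> (\<Union>i. f ` C i)"
      using cov by blast
    then have "hausdorff_content \<delta> s (f ` A) \<le> (\<Sum>i. hausdorff_gauge s (f ` C i))"
      using C bd by (intro hausdorff_content_le) (auto intro: order_trans[OF diam])
    also have "\<dots> \<le> (\<Sum>i. hausdorff_gauge s (C i))"
      using bd diam assms(1)
      by (intro suminf_le hausdorff_gauge_diameter_mono) auto
    finally show "hausdorff_content \<delta> s (f ` A) \<le> (\<Sum>i. hausdorff_gauge s (C i))" .
  qed
  then show ?thesis
    unfolding hausdorff_outer_def by (intro SUP_mono) auto
qed

lemma hausdorff_outer_translation: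
  fixes A :: "'a::real_normed_vector set"
  assumes "0 \<le> s"
  shows "hausdorff_outer s ((+) x ` A) = hausdorff_outer s A"
proof (rule antisym)
  show "hausdorff_outer s ((+) x ` A) \<le> hausdorff_outer s A"
    by (intro hausdorff_outer_nonexpansive_image assms) (simp add: dist_norm)
  have "hausdorff_outer s ((+) (- x) ` (+) x ` A) \<le> hausdorff_outer s ((+) x ` A)"
    by (intro hausdorff_outer_nonexpansive_image assms) (simp add: dist_norm)
  then show "hausdorff_outer s A \<le> hausdorff_outer s ((+) x ` A)"
    by (simp add: image_image)
qed

lemma distr_hausdorff_isometry:
  fixes f :: "'a::metric_space \<Rightarrow> 'b::metric_space"
  assumes "0 \<le> s" and f: "\<And>x y. dist (f x) (f y) \<le> dist x y"
    and g: "\<And>x y. dist (g x) (g y) \<le> dist x y"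
    and inv: "\<And>x. g (f x) = x" "\<And>y. f (g y) = y"
  shows "distr (hausdorff_measure s) borel f = hausdorff_measure s"
proof (rule measure_eqI)
  have [measurable]: "f \<in> borel_measurable borel"
    using f by (intro borel_measurable_continuous_onI continuous_on_iff[THEN iffD2]) (meson order_le_less_trans)
  fix A :: "'b set"
  assume "A \<in> sets (distr (hausdorff_measure s) borel f)"
  then have A[measurable]: "A \<in> sets borel"
    by simp
  have pre: "f -` A = g ` A"
    using inv by (auto simp: image_iff) metis+
  have "A = f ` g ` A"
    using inv by (simp add: image_image)
  then have "hausdorff_outer s (g ` A) = hausdorff_outer s A"
    using hausdorff_outer_nonexpansive_image[OF assms(1) g, of A]
      hausdorff_outer_nonexpansive_image[OF assms(1) f, of "g ` A"] by simp
  moreover have "f -` A \<in> sets borel"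
    using measurable_sets_borel[of f borel A] by simp
  ultimately show "emeasure (distr (hausdorff_measure s) borel f) A = emeasure (hausdorff_measure s) A"
    using assms(1) by (simp add: emeasure_distr emeasure_hausdorff_measure pre)
qed simp

lemma distr_hausdorff_translation:
  fixes x :: "'a::real_normed_vector"
  assumes "0 \<le> s"
  shows "distr (hausdorff_measure s) borel ((+) x) = hausdorff_measure s"
  using assms by (rule distr_hausdorff_isometry[where g = "\<lambda>y. y - x"]) (auto simp: dist_norm)

lemma distr_hausdorff_reflection:
  fixes x :: "'a::real_normed_vector"
  assumes "0 \<le> s"
  shows "distr (hausdorff_measure s) borel ((-) x) = hausdorff_measure s"
  using assms by (rule distr_hausdorff_isometry[where g = "(-) x"]) (auto simp: dist_norm norm_minus_commute)

lemma nn_integral_hausdorff_translation: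
  fixes x :: "'b::euclidean_space"
  assumes "f \<in> borel_measurable borel" "0 \<le> r"
  shows "(\<integral>\<^sup>+u. f (x + u) \<partial>hausdorff_measure r) = (\<integral>\<^sup>+u. f u \<partial>hausdorff_measure r)"
proof -
  have "(\<integral>\<^sup>+u. f u \<partial>hausdorff_measure r) = (\<integral>\<^sup>+u. f u \<partial>distr (hausdorff_measure r) borel ((+) x))"
    using assms(2) by (simp add: distr_hausdorff_translation)
  also have "\<dots> = (\<integral>\<^sup>+u. f (x + u) \<partial>hausdorff_measure r)"
    using assms(1) by (subst nn_integral_distr) auto
  finally show ?thesis ..
qed

lemma nn_integral_hausdorff_reflection:
  fixes x :: "'b::euclidean_space"
  assumes "f \<in> borel_measurable borel" "0 \<le> r"
  shows "(\<integral>\<^sup>+u. f (x - u) \<partial>hausdorff_measure r) = (\<integral>\<^sup>+u. f u \<partial>hausdorff_measure r)"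
proof -
  have "(\<integral>\<^sup>+u. f u \<partial>hausdorff_measure r) = (\<integral>\<^sup>+u. f u \<partial>distr (hausdorff_measure r) borel ((-) x))"
    using assms(2) by (simp add: distr_hausdorff_reflection)
  also have "\<dots> = (\<integral>\<^sup>+u. f (x - u) \<partial>hausdorff_measure r)"
    using assms(1) by (subst nn_integral_distr) auto
  finally show ?thesis ..
qed

lemma translate_borel: "A \<in> sets borel \<Longrightarrow> (+) x ` A \<in> sets (borel :: 'b::euclidean_space measure)"
proof -
  assume [measurable]: "A \<in> sets borel"
  have "(\<lambda>u. u - x) -` A \<in> sets borel"
    using measurable_sets_borel[of "\<lambda>u. u - x" borel A] by simp
  also have "(\<lambda>u. u - x) -` A = (+) x ` A"
    by (force simp: image_iff algebra_simps)
  finally show ?thesis .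
qed

text \<open>On sets of diameter at most \<open>\<delta>\<close> the gauge of order \<open>t\<close> is at most a constant times \<open>\<delta> powr (t - s)\<close> times the
gauge of order \<open>s\<close>, and this factor tends to 0 with \<open>\<delta>\<close>.\<close>

lemma hausdorff_outer_null_higher_order:
  fixes A :: "'a::metric_space set"
  assumes "0 < s" "s < t" and fin: "hausdorff_outer s A < \<infinity>"
  shows "hausdorff_outer t A = 0"
proof -
  define c where "c = unit_ball_vol t / unit_ball_vol s"
  have c: "0 < c"
    using assms by (simp add: c_def)
  have le: "hausdorff_content \<delta> t A \<le> ennreal (c * \<delta> powr (t - s)) * hausdorff_outer s A"
    if "0 < \<delta>" for \<delta>
  proof -
    define k where "k = c * \<delta> powr (t - s)"
    have k: "0 < k"
      using c that by (simp add: k_def)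
    have scaled: "hausdorff_content \<delta> t A \<le> (\<Sum>i. ennreal k * hausdorff_gauge s (C i))"
      if cov: "A \<subseteq> (\<Union>i. C i)" and C: "\<And>i. bounded (C i)" "\<And>i. diameter (C i) \<le> \<delta>" for C :: "nat \<Rightarrow> 'a set"
    proof -
      have "hausdorff_gauge t (C i) \<le> ennreal k * hausdorff_gauge s (C i)" for i
      proof (cases "C i = {}")
        case False
        have d: "0 \<le> diameter (C i)" "diameter (C i) \<le> \<delta>"
          using C by (auto intro: diameter_ge_0)
        have "(diameter (C i) / 2) powr t = (diameter (C i) / 2) powr (t - s) * (diameter (C i) / 2) powr s"
          using powr_add[of "diameter (C i) / 2" "t - s" s] by simp
        also have "\<dots> \<le> \<delta> powr (t - s) * (diameter (C i) / 2) powr s"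
          using d assms by (intro mult_right_mono powr_mono2) auto
        finally have "unit_ball_vol t * (diameter (C i) / 2) powr t
            \<le> unit_ball_vol t * (\<delta> powr (t - s) * (diameter (C i) / 2) powr s)"
          using assms by (intro mult_left_mono) auto
        also have "\<dots> = c * \<delta> powr (t - s) * (unit_ball_vol s * (diameter (C i) / 2) powr s)"
          using assms unit_ball_vol_pos[of s] by (simp add: c_def del: unit_ball_vol_pos)
        finally show ?thesis
          using False assms k by (simp add: hausdorff_gauge_def ennreal_leI k_def flip: ennreal_mult)
      qed (simp add: hausdorff_gauge_def)
      then have "(\<Sum>i. hausdorff_gauge t (C i)) \<le> (\<Sum>i. ennreal k * hausdorff_gauge s (C i))"
        by (intro suminf_le) auto
      with hausdorff_content_le[OF cov C, of t] show ?thesis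
        by (rule order_trans)
    qed
    have "ennreal (1 / k) * hausdorff_content \<delta> t A \<le> hausdorff_content \<delta> s A"
      unfolding hausdorff_content_def[of \<delta> s A]
    proof (rule INF_greatest, clarify)
      fix C :: "nat \<Rightarrow> 'a set"
      assume "A \<subseteq> (\<Union>i. C i)" "\<forall>i. bounded (C i) \<and> diameter (C i) \<le> \<delta>"
      then have "ennreal (1 / k) * hausdorff_content \<delta> t A
          \<le> ennreal (1 / k) * (\<Sum>i. ennreal k * hausdorff_gauge s (C i))"
        by (intro mult_left_mono scaled) auto
      also have "\<dots> = (\<Sum>i. hausdorff_gauge s (C i))"
        using k by (simp add: mult.assoc[symmetric] ennreal_mult[symmetric])
      finally show "ennreal (1 / k) * hausdorff_content \<delta> t A \<le> (\<Sum>i. hausdorff_gauge s (C i))" .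
    qed
    also have "\<dots> \<le> hausdorff_outer s A"
      unfolding hausdorff_outer_def using that by (intro SUP_upper) auto
    finally have "ennreal k * (ennreal (1 / k) * hausdorff_content \<delta> t A) \<le> ennreal k * hausdorff_outer s A"
      by (intro mult_left_mono) auto
    moreover have "ennreal k * ennreal (1 / k) = 1"
      using k by (simp flip: ennreal_mult)
    ultimately show ?thesis
      by (simp add: mult.assoc[symmetric] flip: k_def)
  qed
  have "hausdorff_content \<epsilon> t A \<le> 0" if "0 < \<epsilon>" for \<epsilon>
  proof (rule tendsto_lowerbound)
    obtain h where h: "hausdorff_outer s A = ennreal h" "0 \<le> h"
      using fin by (cases "hausdorff_outer s A") auto
    have "((\<lambda>\<delta>. c * \<delta> powr (t - s) * h) \<longlongrightarrow> c * 0 powr (t - s) * h) (at_right 0)"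
      using assms by (intro tendsto_intros) (auto intro!: eventually_at_rightI[of 0 1])
    then have "((\<lambda>\<delta>. ennreal (c * \<delta> powr (t - s) * h)) \<longlongrightarrow> ennreal (c * 0 powr (t - s) * h)) (at_right 0)"
      by (rule tendsto_ennrealI)
    then show "((\<lambda>\<delta>. ennreal (c * \<delta> powr (t - s)) * hausdorff_outer s A) \<longlongrightarrow> 0) (at_right 0)"
      using c h by (simp add: ennreal_mult)
    show "\<forall>\<^sub>F \<delta> in at_right 0. hausdorff_content \<epsilon> t A \<le> ennreal (c * \<delta> powr (t - s)) * hausdorff_outer s A"
    proof (rule eventually_at_rightI[of 0 \<epsilon>])
      fix \<delta>
      assume "\<delta> \<in> {0<..<\<epsilon>}"
      then show "hausdorff_content \<epsilon> t A \<le> ennreal (c * \<delta> powr (t - s)) * hausdorff_outer s A"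
        using le[of \<delta>] hausdorff_content_antimono[of \<delta> \<epsilon> t A] by (auto intro: order_trans)
    qed (use that in auto)
  qed simp
  then have "hausdorff_outer t A \<le> 0"
    unfolding hausdorff_outer_def by (intro SUP_least) auto
  then show ?thesis
    by simp
qed

text \<open>The balls of radius \<open>r\<close> around the points are disjoint and contained in \<open>cball 0 (R + r)\<close>, so their
Lebesgue measures add up to at most that of this ball.\<close>

lemma packing_card_le:
  fixes S :: "'a::euclidean_space set" and r R :: real
  assumes "finite S" "S \<subseteq> cball 0 R" "0 < r" "0 \<le> R"
    and sep: "\<And>x y. x \<in> S \<Longrightarrow> y \<in> S \<Longrightarrow> x \<noteq> y \<Longrightarrow> 2 * r \<le> dist x y"
  shows "card S * r ^ DIM('a) \<le> (R + r) ^ DIM('a)"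
proof -
  have "disjoint_family_on (\<lambda>x. ball x r) S"
    unfolding disjoint_family_on_def
  proof (intro ballI impI equals0I)
    fix x y z
    assume "x \<in> S" "y \<in> S" "x \<noteq> y" "z \<in> ball x r \<inter> ball y r"
    then show False
      using sep[of x y] dist_triangle2[of x y z] by (simp add: dist_commute)
  qed
  then have "(\<Sum>x\<in>S. emeasure lborel (ball x r)) = emeasure lborel (\<Union>x\<in>S. ball x r)"
    using assms(1) by (intro sum_emeasure) auto
  also have "\<dots> \<le> emeasure lborel (cball (0::'a) (R + r))"
  proof (intro emeasure_mono UN_least subsetI)
    fix x z
    assume "x \<in> S" "z \<in> ball x r"
    then show "z \<in> cball 0 (R + r)"
      using assms(2) dist_triangle[of 0 z x] by (force simp: dist_commute)
  qed simp
  finally have "ennreal (real (card S) * (unit_ball_vol DIM('a) * r ^ DIM('a)))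
      \<le> ennreal (unit_ball_vol DIM('a) * (R + r) ^ DIM('a))"
    using assms by (simp add: emeasure_ball emeasure_cball ennreal_mult ennreal_of_nat_eq_real_of_nat)
  then have "unit_ball_vol DIM('a) * (card S * r ^ DIM('a)) \<le> unit_ball_vol DIM('a) * (R + r) ^ DIM('a)"
    using assms by (subst (asm) ennreal_le_iff) (auto simp: algebra_simps)
  then show ?thesis
    by simp
qed

text \<open>The covers of small mesh come from a maximal separated set: its cardinality is bounded by
packing, and by maximality the balls around its points cover.\<close>

lemma hausdorff_outer_cball_finite:
  assumes "0 \<le> R"
  shows "hausdorff_outer DIM('a) (cball (0::'a::euclidean_space) R) < \<infinity>"
proof -
  let ?d = "DIM('a)"
  define c where "c = unit_ball_vol ?d * (2 * (R + 1)) ^ ?d"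
  have small: "hausdorff_content \<delta> ?d (cball (0::'a) R) \<le> ennreal c" if \<delta>: "0 < \<delta>" "\<delta> \<le> 1" for \<delta>
  proof -
    \<comment> \<open>Separation \<open>2 * r = \<delta> / 2\<close> makes the covering balls of radius \<open>2 * r\<close> have diameter \<open>\<delta>\<close>.\<close>
    define r where "r = \<delta> / 4"
    define sep where "sep S \<longleftrightarrow> finite S \<and> S \<subseteq> cball (0::'a) R \<and>
      (\<forall>x\<in>S. \<forall>y\<in>S. x \<noteq> y \<longrightarrow> 2 * r \<le> dist x y)" for S
    have r: "0 < r" using \<delta> by (simp add: r_def)
    have pack: "real (card S) * r ^ ?d \<le> (R + r) ^ ?d" if "sep S" for S
      using that r assms by (intro packing_card_le) (auto simp: sep_def)
    have bound: "card S \<le> nat \<lfloor>(R + r) ^ ?d / r ^ ?d\<rfloor>" if "sep S" for S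
    proof -
      have "real (card S) \<le> (R + r) ^ ?d / r ^ ?d"
        using pack[OF that] r by (simp add: field_simps)
      then show ?thesis by linarith
    qed
    have "sep {}"
      by (simp add: sep_def)
    then obtain S where S: "sep S" and max: "\<And>T. sep T \<Longrightarrow> card T \<le> card S"
      using ex_has_greatest_nat[of sep "{}" card "Suc (nat \<lfloor>(R + r) ^ ?d / r ^ ?d\<rfloor>)"] bound
      by (auto simp: less_Suc_eq_le)
    have cov: "\<exists>x\<in>S. y \<in> cball x (2 * r)" if y: "y \<in> cball 0 R" for y
    proof (rule ccontr)
      assume *: "\<not> ?thesis"
      then have "sep (insert y S)"
        using S y by (auto simp: sep_def dist_commute)
      moreover have "y \<notin> S"
        using * r by auto
      ultimately show False
        using max[of "insert y S"] S by (simp add: sep_def)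
    qed
    obtain e where e: "bij_betw e {..<card S} S"
      using S ex_bij_betw_nat_finite[of S] by (auto simp: sep_def atLeast0LessThan)
    define C where "C i = (if i < card S then cball (e i) (2 * r) else {})" for i
    have "hausdorff_content \<delta> ?d (cball (0::'a) R) \<le> (\<Sum>i. hausdorff_gauge ?d (C i))"
    proof (rule hausdorff_content_le)
      show "cball 0 R \<subseteq> (\<Union>i. C i)"
      proof
        fix y :: 'a
        assume "y \<in> cball 0 R"
        then obtain x where x: "x \<in> S" "y \<in> cball x (2 * r)"
          using cov by blast
        then obtain i where "i < card S" "x = e i"
          using e by (auto simp: bij_betw_def)
        with x show "y \<in> (\<Union>i. C i)"
          by (intro UN_I[of i]) (auto simp: C_def)
      qed
    qed (use r in \<open>auto simp: C_def r_def\<close>)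
    also have "\<dots> = (\<Sum>i<card S. hausdorff_gauge ?d (C i))"
      by (rule suminf_finite) (auto simp: C_def hausdorff_gauge_def)
    also have "\<dots> = (\<Sum>i<card S. ennreal (unit_ball_vol ?d * (2 * r) ^ ?d))"
      using r by (intro sum.cong) (auto simp: C_def hausdorff_gauge_def powr_realpow)
    also have "\<dots> = ennreal (card S * (unit_ball_vol ?d * (2 * r) ^ ?d))"
      using r by (simp add: ennreal_mult ennreal_of_nat_eq_real_of_nat)
    also have "\<dots> \<le> ennreal c"
    proof (rule ennreal_leI)
      have "card S * (unit_ball_vol ?d * (2 * r) ^ ?d) = unit_ball_vol ?d * 2 ^ ?d * (card S * r ^ ?d)"
        by (simp add: power_mult_distrib)
      also have "\<dots> \<le> unit_ball_vol ?d * 2 ^ ?d * (R + r) ^ ?d"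
        using pack[OF S] by (intro mult_left_mono) auto
      also have "\<dots> \<le> unit_ball_vol ?d * 2 ^ ?d * (R + 1) ^ ?d"
        using assms r \<delta> by (intro mult_left_mono power_mono) (auto simp: r_def)
      finally show "card S * (unit_ball_vol ?d * (2 * r) ^ ?d) \<le> c"
        by (simp only: c_def power_mult_distrib mult.assoc)
    qed
    finally show ?thesis .
  qed
  have "hausdorff_content \<delta> ?d (cball (0::'a) R) \<le> ennreal c" if "0 < \<delta>" for \<delta>
    using small[of "min \<delta> 1"] hausdorff_content_antimono[of "min \<delta> 1" \<delta> ?d "cball (0::'a) R"] that
    by (auto intro: order_trans)
  then have "hausdorff_outer ?d (cball (0::'a) R) \<le> ennreal c"
    unfolding hausdorff_outer_def by (intro SUP_least) auto
  then show ?thesis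
    by (simp add: order_le_less_trans)
qed

lemma UN_cball_nat: "(\<Union>m::nat. cball (0::'b::real_normed_vector) (real m)) = UNIV"
  using real_arch_simple by (auto simp: set_eq_iff)

lemma sigma_finite_hausdorff_volume: "sigma_finite_measure (hausdorff_volume :: 'a::euclidean_space measure)"
proof
  let ?A = "range (\<lambda>m::nat. cball (0::'a) (real m))"
  have "emeasure (hausdorff_volume :: 'a measure) (cball 0 (real m)) \<noteq> \<infinity>" for m
    using hausdorff_outer_cball_finite[of "real m", where 'a = 'a]
    by (simp add: emeasure_hausdorff_measure)
  then show "\<exists>A. countable A \<and> A \<subseteq> sets (hausdorff_volume :: 'a measure) \<and>
      \<Union> A = space (hausdorff_volume :: 'a measure) \<and> (\<forall>a\<in>A. emeasure (hausdorff_volume :: 'a measure) a \<noteq> \<infinity>)"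
    by (intro exI[of _ ?A]) (auto simp: UN_cball_nat)
qed

section \<open>Measurability of Hausdorff measure on closed sets\<close>

text \<open>Sets in a cover may be taken open, since the gauge depends continuously on the diameter.\<close>

lemma hausdorff_gauge_open_superset:
  fixes C :: "'a::metric_space set"
  assumes "0 < s" "bounded C" "diameter C \<le> \<delta>" "\<delta> < \<epsilon>" "0 < e"
  shows "\<exists>U. open U \<and> C \<subseteq> U \<and> bounded U \<and> diameter U \<le> \<epsilon> \<and>
    hausdorff_gauge s U \<le> hausdorff_gauge s C + ennreal e"
proof (cases "C = {}")
  case True
  then show ?thesis
    using assms diameter_ge_0[of C] by (intro exI[of _ "{}"]) (simp add: hausdorff_gauge_def)
next
  case False
  have d: "0 \<le> diameter C"
    using assms by (simp add: diameter_ge_0)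
  let ?v = "\<lambda>r. unit_ball_vol s * ((diameter C + 2 * r) / 2) powr s"
  have "(?v \<longlongrightarrow> ?v 0) (at_right 0)"
    using assms(1) d by (intro tendsto_intros) (auto intro!: eventually_at_rightI[of 0 1])
  then have "\<forall>\<^sub>F r in at_right 0. ?v r < ?v 0 + e"
    using assms by (intro order_tendstoD) auto
  moreover have "\<forall>\<^sub>F r in at_right 0. 2 * r < \<epsilon> - \<delta>"
    using assms by (intro eventually_at_rightI[of 0 "(\<epsilon> - \<delta>) / 2"]) auto
  ultimately have "\<forall>\<^sub>F r in at_right (0::real). ?v r < ?v 0 + e \<and> 2 * r < \<epsilon> - \<delta> \<and> 0 < r"
    by (intro eventually_conj eventually_at_right_less)
  then obtain r where r: "?v r < ?v 0 + e" "2 * r < \<epsilon> - \<delta>" "0 < r"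
    using eventually_happens'[OF trivial_limit_at_right_real] by blast
  define U where "U = (\<Union>x\<in>C. ball x r)"
  have near: "dist u v \<le> diameter C + 2 * r" if "u \<in> U" "v \<in> U" for u v
  proof -
    from that(1) obtain x where x: "x \<in> C" "dist x u < r"
      by (auto simp: U_def)
    from that(2) obtain y where y: "y \<in> C" "dist y v < r"
      by (auto simp: U_def)
    note xy = x y
    have "dist x y \<le> diameter C"
      using assms xy by (intro diameter_bounded_bound)
    with xy show ?thesis
      using dist_triangle[of u v x] dist_triangle[of x v y] by (simp add: dist_commute)
  qed
  have U: "bounded U" "diameter U \<le> diameter C + 2 * r"
    using near d r by (auto simp: bounded_two_points intro!: diameter_leI)
  have "(diameter U / 2) powr s \<le> ((diameter C + 2 * r) / 2) powr s"
    using U assms(1) by (intro powr_mono2) (auto simp: diameter_ge_0)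
  then have "unit_ball_vol s * (diameter U / 2) powr s \<le> ?v r"
    using assms(1) by (intro mult_left_mono) auto
  with r(1) have "unit_ball_vol s * (diameter U / 2) powr s \<le> ?v 0 + e"
    by linarith
  then have "hausdorff_gauge s U \<le> ennreal (?v 0 + e)"
    using assms(1) by (simp add: hausdorff_gauge_def ennreal_leI)
  also have "\<dots> = hausdorff_gauge s C + ennreal e"
    using assms False by (simp add: hausdorff_gauge_def)
  finally have "hausdorff_gauge s U \<le> hausdorff_gauge s C + ennreal e" .
  moreover have "open U" "C \<subseteq> U"
    using r by (auto simp: U_def)
  ultimately show ?thesis
    using U r(2) assms(3) by (intro exI[of _ U]) auto
qed

lemma hausdorff_content_open_cover:
  fixes A :: "'a::metric_space set"
  assumes "0 < s" "hausdorff_content \<delta> s A < c" "\<delta> < \<epsilon>"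
  shows "\<exists>U :: nat \<Rightarrow> 'a set. (\<forall>i. open (U i) \<and> bounded (U i) \<and> diameter (U i) \<le> \<epsilon>) \<and> A \<subseteq> (\<Union>i. U i) \<and>
    (\<Sum>i. hausdorff_gauge s (U i)) < c"
proof -
  obtain C :: "nat \<Rightarrow> 'a set" where C: "A \<subseteq> (\<Union>i. C i)" "\<And>i. bounded (C i)" "\<And>i. diameter (C i) \<le> \<delta>"
      "(\<Sum>i. hausdorff_gauge s (C i)) < c"
    using assms(2) unfolding hausdorff_content_def INF_less_iff by auto
  obtain e where e: "0 < e" "(\<Sum>i. hausdorff_gauge s (C i)) + ennreal e < c"
  proof (cases c)
    case (real b)
    then obtain a where a: "(\<Sum>i. hausdorff_gauge s (C i)) = ennreal a" "0 \<le> a" "a < b"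
      using C(4) by (cases "\<Sum>i. hausdorff_gauge s (C i)") (auto simp: ennreal_less_iff)
    then show ?thesis
      using real by (intro that[of "(b - a) / 2"]) (auto simp: ennreal_less_iff field_simps simp flip: ennreal_plus)
  next
    case top
    then show ?thesis
      using C(4) by (intro that[of 1]) auto
  qed
  have "\<exists>U. open U \<and> C i \<subseteq> U \<and> bounded U \<and> diameter U \<le> \<epsilon> \<and>
      hausdorff_gauge s U \<le> hausdorff_gauge s (C i) + ennreal (e * (1/2) ^ Suc i)" for i
    using assms C e by (intro hausdorff_gauge_open_superset) auto
  then obtain U where U: "\<And>i. open (U i)" "\<And>i. C i \<subseteq> U i" "\<And>i. bounded (U i)" "\<And>i. diameter (U i) \<le> \<epsilon>"
      "\<And>i. hausdorff_gauge s (U i) \<le> hausdorff_gauge s (C i) + ennreal (e * (1/2) ^ Suc i)"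
    by metis
  have "(\<Sum>i. hausdorff_gauge s (U i)) \<le> (\<Sum>i. hausdorff_gauge s (C i) + ennreal (e * (1/2) ^ Suc i))"
    by (intro suminf_le U) auto
  also have "\<dots> = (\<Sum>i. hausdorff_gauge s (C i)) + (\<Sum>i. ennreal e * ennreal ((1/2) ^ Suc i))"
    using e by (subst suminf_add[symmetric])
      (auto simp del: ennreal_suminf_cmult simp add: ennreal_mult[symmetric])
  also have "\<dots> = (\<Sum>i. hausdorff_gauge s (C i)) + ennreal e"
    unfolding ennreal_suminf_cmult
    by (subst suminf_ennreal_eq[OF zero_le_power power_half_series]) auto
  finally have "(\<Sum>i. hausdorff_gauge s (U i)) < c"
    using e by simp
  moreover have "A \<subseteq> (\<Union>i. U i)"
    using C(1) U(2) by blast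
  ultimately show ?thesis
    using U by (intro exI[of _ U]) auto
qed

lemma openin_fell_miss: "compact K \<Longrightarrow> openin fell_topology {F. closed F \<and> F \<inter> K = {}}"
  unfolding fell_topology_def by (rule topology_generated_by_Basis) auto

lemma sets_fell_borelI: "openin fell_topology U \<Longrightarrow> U \<in> sets fell_borel"
  unfolding fell_borel_def using openin_subset topspace_fell_topology
  by (subst sets_measure_of) auto

text \<open>That \<open>F \<inter> K\<close> is covered by a given open cover says that \<open>F\<close> misses the compact set \<open>K\<close> minus the cover,
which is an open condition in the Fell topology. Hence so is the existence of an open cover with small gauge
sum, even though it is a union over uncountably many covers, and \<open>{F. \<H>\<^sup>s(F \<inter> K) \<le> c}\<close> is a countable
intersection of such sets.\<close>

lemma hausdorff_outer_compact_part_measurable: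
  fixes K :: "'a::metric_space set"
  assumes s: "0 < s" and K: "compact K"
  shows "(\<lambda>F. hausdorff_outer s (F \<inter> K)) \<in> borel_measurable fell_borel"
proof (rule borel_measurableI_le)
  fix c :: ennreal
  show "{F \<in> space fell_borel. hausdorff_outer s (F \<inter> K) \<le> c} \<in> sets fell_borel"
  proof (cases "c = \<top>")
    case False
    define \<U> where "\<U> m k = {U :: nat \<Rightarrow> 'a set. (\<forall>i. open (U i) \<and> bounded (U i) \<and> diameter (U i) \<le> 1 / real (Suc m)) \<and>
      (\<Sum>i. hausdorff_gauge s (U i)) < c + ennreal (1 / real (Suc k))}" for m k :: nat
    define V where "V m k = (\<Union>U\<in>\<U> m k. {F. closed F \<and> F \<inter> (K - (\<Union>i. U i)) = {}})" for m k
    have "V m k \<in> sets fell_borel" for m k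
    proof (rule sets_fell_borelI)
      have "compact (K - (\<Union>i. U i))" if "U \<in> \<U> m k" for U
        using K that by (intro compact_diff open_UN) (auto simp: \<U>_def)
      then show "openin fell_topology (V m k)"
        unfolding V_def by (intro openin_Union) (auto intro: openin_fell_miss)
    qed
    moreover have "{F \<in> space fell_borel. hausdorff_outer s (F \<inter> K) \<le> c} = (\<Inter>m k. V m k)"
    proof (intro set_eqI iffI)
      fix F
      assume F: "F \<in> {F \<in> space fell_borel. hausdorff_outer s (F \<inter> K) \<le> c}"
      have "F \<in> V m k" for m k
      proof -
        \<comment> \<open>The mesh is halved to leave room for enlarging the covering sets to open ones.\<close>
        have "hausdorff_content (1 / real (Suc m) / 2) s (F \<inter> K) \<le> hausdorff_outer s (F \<inter> K)"
          unfolding hausdorff_outer_def by (intro SUP_upper) auto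
        also have "\<dots> < c + ennreal (1 / real (Suc k))"
        proof (rule order_le_less_trans)
          show "hausdorff_outer s (F \<inter> K) \<le> c"
            using F by simp
          show "c < c + ennreal (1 / real (Suc k))"
            using False by (cases c) (auto simp flip: ennreal_plus simp: ennreal_less_iff)
        qed
        finally have small: "hausdorff_content (1 / real (Suc m) / 2) s (F \<inter> K) < c + ennreal (1 / real (Suc k))" .
        have half: "r / 2 < r" if "0 < r" for r :: real
          using that by simp
        have "1 / real (Suc m) / 2 < 1 / real (Suc m)"
          by (rule half) simp
        from hausdorff_content_open_cover[OF s small this]
        obtain U :: "nat \<Rightarrow> 'a set" where U: "\<forall>i. open (U i) \<and> bounded (U i) \<and> diameter (U i) \<le> 1 / real (Suc m)"
            "F \<inter> K \<subseteq> (\<Union>i. U i)" "(\<Sum>i. hausdorff_gauge s (U i)) < c + ennreal (1 / real (Suc k))"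
          by blast
        then have "U \<in> \<U> m k" "F \<inter> (K - (\<Union>i. U i)) = {}"
          by (auto simp: \<U>_def)
        then show ?thesis
          using F by (auto simp: V_def space_fell_borel)
      qed
      then show "F \<in> (\<Inter>m k. V m k)"
        by blast
    next
      fix F
      assume F: "F \<in> (\<Inter>m k. V m k)"
      then have "F \<in> V 0 0"
        by blast
      then have "closed F"
        by (auto simp: V_def)
      have bound: "hausdorff_content (1 / real (Suc m)) s (F \<inter> K) \<le> c + ennreal e" if "0 < e" for m e
      proof -
        obtain k where k: "1 / real (Suc k) < e"
          using \<open>0 < e\<close> by (rule nat_approx_posE)
        have "F \<in> V m k"
          using F by blast
        then obtain U where U: "U \<in> \<U> m k" "F \<inter> K \<subseteq> (\<Union>i. U i)"
          unfolding V_def by blast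
        then have "hausdorff_content (1 / real (Suc m)) s (F \<inter> K) \<le> (\<Sum>i. hausdorff_gauge s (U i))"
          by (intro hausdorff_content_le) (auto simp: \<U>_def)
        also have "\<dots> \<le> c + ennreal (1 / real (Suc k))"
          using U(1) by (simp only: \<U>_def mem_Collect_eq less_imp_le)
        also have "\<dots> \<le> c + ennreal e"
          using k by (intro add_left_mono ennreal_leI) simp
        finally show ?thesis .
      qed
      have *: "hausdorff_content (1 / real (Suc m)) s (F \<inter> K) \<le> c" for m
        by (rule ennreal_le_epsilon) (rule bound)
      have "hausdorff_content \<delta> s (F \<inter> K) \<le> c" if "0 < \<delta>" for \<delta>
      proof -
        obtain m where "1 / real (Suc m) < \<delta>"
          using \<open>0 < \<delta>\<close> by (rule nat_approx_posE)
        then show ?thesis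
          by (intro order_trans[OF hausdorff_content_antimono *]) (rule less_imp_le)
      qed
      then show "F \<in> {F \<in> space fell_borel. hausdorff_outer s (F \<inter> K) \<le> c}"
        using \<open>closed F\<close> unfolding hausdorff_outer_def by (auto simp: space_fell_borel intro!: SUP_least)
    qed
    ultimately show ?thesis
      by simp
  qed simp
qed

text \<open>A point \<open>u\<close> lies outside the closed set \<open>Z x\<close> iff some bounded basic open set around \<open>u\<close> has a closure
missed by \<open>Z x\<close>. So the complement of the graph is a countable union of measurable rectangles.\<close>

lemma graph_of_random_closed_set_measurable:
  fixes Z :: "'x \<Rightarrow> 'a::euclidean_space set"
  assumes Z: "Z \<in> X \<rightarrow>\<^sub>M fell_borel"
  shows "{(x, u). x \<in> space X \<and> u \<in> Z x} \<in> sets (X \<Otimes>\<^sub>M borel)"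
proof -
  obtain \<B> :: "'a set set" where \<B>: "countable \<B>" "\<And>B. B \<in> \<B> \<Longrightarrow> open B"
      "\<And>S. open S \<Longrightarrow> \<exists>\<C>\<subseteq>\<B>. S = \<Union>\<C>"
    using univ_second_countable by metis
  define M where "M B = {x \<in> space X. Z x \<inter> closure B = {}}" for B
  have cl: "closed (Z x)" if "x \<in> space X" for x
    using measurable_space[OF Z that] by (simp add: space_fell_borel)
  have "M B \<in> sets X" if "bounded B" for B
  proof -
    have "{F. closed F \<and> F \<inter> closure B = {}} \<in> sets fell_borel"
      using that by (intro sets_fell_borelI openin_fell_miss) (simp add: compact_closure)
    then have "Z -` {F. closed F \<and> F \<inter> closure B = {}} \<inter> space X \<in> sets X"
      by (rule measurable_sets[OF Z])
    also have "Z -` {F. closed F \<and> F \<inter> closure B = {}} \<inter> space X = M B"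
      using cl by (auto simp: M_def)
    finally show ?thesis .
  qed
  then have "(\<Union>B\<in>{B\<in>\<B>. bounded B}. M B \<times> B) \<in> sets (X \<Otimes>\<^sub>M borel)"
    using \<B>(1,2) by (intro sets.countable_UN' pair_measureI) auto
  moreover have "{(x, u). x \<in> space X \<and> u \<in> Z x} =
      space (X \<Otimes>\<^sub>M borel) - (\<Union>B\<in>{B\<in>\<B>. bounded B}. M B \<times> B)"
  proof -
    have away: "\<exists>B\<in>\<B>. bounded B \<and> Z x \<inter> closure B = {} \<and> u \<in> B" if x: "x \<in> space X" "u \<notin> Z x" for x u
    proof -
      have "open (- Z x)"
        using cl[OF x(1)] by auto
      then obtain e where e: "0 < e" "cball u e \<subseteq> - Z x"
        using x(2) by (auto simp: open_contains_cball)
      obtain \<C> where \<C>: "\<C> \<subseteq> \<B>" "ball u e = \<Union>\<C>"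
        using \<B>(3)[of "ball u e"] by auto
      then obtain B where B: "B \<in> \<C>" "u \<in> B"
        using e(1) by (metis Union_iff centre_in_ball)
      then have "B \<subseteq> cball u e"
        using \<C> ball_subset_cball by blast
      then have "bounded B" "closure B \<subseteq> cball u e"
        by (auto intro: bounded_subset simp: closure_minimal simp del: mem_cball)
      with B \<C> e show ?thesis
        by blast
    qed
    show ?thesis
    proof (intro set_eqI iffI)
      fix p
      assume "p \<in> {(x, u). x \<in> space X \<and> u \<in> Z x}"
      then show "p \<in> space (X \<Otimes>\<^sub>M borel) - (\<Union>B\<in>{B\<in>\<B>. bounded B}. M B \<times> B)"
        using closure_subset by (auto simp: M_def space_pair_measure)
    next
      fix p
      assume p: "p \<in> space (X \<Otimes>\<^sub>M borel) - (\<Union>B\<in>{B\<in>\<B>. bounded B}. M B \<times> B)"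
      then have "fst p \<in> space X"
        by (auto simp: space_pair_measure)
      moreover from this have "snd p \<in> Z (fst p)"
        using away[of "fst p" "snd p"] p by (cases p) (auto simp: M_def)
      ultimately show "p \<in> {(x, u). x \<in> space X \<and> u \<in> Z x}"
        by (cases p) simp
    qed
  qed
  ultimately show ?thesis
    by auto
qed

section \<open>Kernels, counting measures and Campbell formula\<close>

text \<open>A kernel that is finite on each member of an exhausting sequence \<open>B\<close> reduces to kernels of
subprobabilities: restrict to \<open>B m\<close>, rescale to mass at most 1, and let \<open>m\<close> grow.\<close>

lemma nn_integral_kernel_measurable:
  fixes \<kappa> :: "'x \<Rightarrow> 'y measure"
  assumes gen: "sets N = sigma_sets (space N) E" "Int_stable E" "E \<subseteq> Pow (space N)"
    and ne: "space N \<noteq> {}"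
    and sets: "\<And>x. x \<in> space X \<Longrightarrow> sets (\<kappa> x) = sets N"
    and B: "\<And>m::nat. B m \<in> sets N" "incseq B" "(\<Union>m. B m) = space N"
    and fin: "\<And>x m. x \<in> space X \<Longrightarrow> emeasure (\<kappa> x) (B m) < \<infinity>"
    and meas: "\<And>m C. C \<in> insert (space N) E \<Longrightarrow> (\<lambda>x. emeasure (\<kappa> x) (C \<inter> B m)) \<in> borel_measurable X"
    and f: "(\<lambda>(x, y). f x y) \<in> borel_measurable (X \<Otimes>\<^sub>M N)"
  shows "(\<lambda>x. \<integral>\<^sup>+y. f x y \<partial>\<kappa> x) \<in> borel_measurable X"
proof -
  \<comment> \<open>Adding 1 keeps the normalising factor away from 0 when \<open>\<kappa> x\<close> gives no mass to \<open>B m\<close>.\<close>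
  define c where "c m x = 1 + emeasure (\<kappa> x) (B m)" for m x
  define \<rho> where "\<rho> m x = scale_measure (inverse (c m x)) (density (\<kappa> x) (indicator (B m)))" for m x
  have [measurable]: "c m \<in> borel_measurable X" for m
    using meas[of "space N" m] B(1)[THEN sets.sets_into_space] unfolding c_def
    by (auto simp: Int_absorb1)
  have c: "0 < c m x" "c m x < \<infinity>" if "x \<in> space X" for m x
    using fin[OF that, of m] by (auto simp: c_def add_pos_nonneg)
  have inv_c: "inverse (c m x) * c m x = 1" and inv_c': "c m x * inverse (c m x) = 1"
    if "x \<in> space X" for x m
    using c[OF that, of m] by (auto simp: ennreal_divide_self mult.commute simp flip: divide_ennreal_def)
  have space: "space (\<kappa> x) = space N" if "x \<in> space X" for x
    using sets[OF that] by (rule sets_eq_imp_space_eq)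
  have dens: "emeasure (density (\<kappa> x) (indicator (B m))) C = emeasure (\<kappa> x) (C \<inter> B m)"
    if "x \<in> space X" "C \<in> sets N" for x m C
    using that B(1) by (simp add: emeasure_restricted sets Int_commute)
  have \<rho>: "\<rho> m \<in> X \<rightarrow>\<^sub>M subprob_algebra N" for m
  proof (rule measurable_subprob_algebra_generated[OF gen])
    fix x
    assume x: "x \<in> space X"
    show "subprob_space (\<rho> m x)"
    proof
      have "emeasure (\<rho> m x) (space (\<rho> m x)) = inverse (c m x) * emeasure (\<kappa> x) (B m)"
        using x B(1)[THEN sets.sets_into_space]
        by (simp add: \<rho>_def dens space space_scale_measure Int_absorb1)
      also have "\<dots> \<le> inverse (c m x) * c m x"
        by (intro mult_left_mono) (auto simp: c_def)
      also have "\<dots> = 1"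
        using c[OF x, of m] by (simp add: inv_c x)
      finally show "emeasure (\<rho> m x) (space (\<rho> m x)) \<le> 1" .
      show "space (\<rho> m x) \<noteq> {}"
        using x ne by (simp add: \<rho>_def space space_scale_measure)
    qed
    show "sets (\<rho> m x) = sets N"
      using x by (simp add: \<rho>_def sets)
  next
    have *: "(\<lambda>x. emeasure (\<rho> m x) C) \<in> borel_measurable X" if "C \<in> insert (space N) E" for C
    proof -
      have "C \<in> sets N"
        using that gen by auto
      then have "(\<lambda>x. emeasure (\<rho> m x) C) \<in> borel_measurable X \<longleftrightarrow>
          (\<lambda>x. inverse (c m x) * emeasure (\<kappa> x) (C \<inter> B m)) \<in> borel_measurable X"
        by (intro measurable_cong) (simp add: \<rho>_def dens)
      also have \<dots>
        using meas[OF that, of m] by simp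
      finally show ?thesis .
    qed
    then show "C \<in> E \<Longrightarrow> (\<lambda>x. emeasure (\<rho> m x) C) \<in> borel_measurable X" 
      "(\<lambda>x. emeasure (\<rho> m x) (space N)) \<in> borel_measurable X" for C
      by auto
  qed
  have [measurable]: "(\<lambda>x. \<integral>\<^sup>+y. f x y \<partial>\<rho> m x) \<in> borel_measurable X" for m
    by (rule nn_integral_measurable_subprob_algebra2[OF f \<rho>])
  have fx: "f x \<in> borel_measurable (\<kappa> x)" if "x \<in> space X" for x
    using measurable_Pair2[OF f that] sets[OF that] by (simp cong: measurable_cong_sets)
  have "(\<integral>\<^sup>+y. f x y \<partial>\<kappa> x) = (SUP m. c m x * (\<integral>\<^sup>+y. f x y \<partial>\<rho> m x))" if x: "x \<in> space X" for x
  proof -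
    have "c m x * (\<integral>\<^sup>+y. f x y \<partial>\<rho> m x) = (\<integral>\<^sup>+y. f x y * indicator (B m) y \<partial>\<kappa> x)" for m
    proof -
      have [measurable]: "B m \<in> sets (\<kappa> x)"
        using x B(1) by (simp add: sets)
      have "(\<integral>\<^sup>+y. f x y \<partial>\<rho> m x) = inverse (c m x) * (\<integral>\<^sup>+y. f x y * indicator (B m) y \<partial>\<kappa> x)"
        unfolding \<rho>_def using fx[OF x]
        by (subst nn_integral_scale_measure) (auto simp: nn_integral_density mult.commute)
      then show ?thesis
        using c[OF x, of m] by (simp add: mult.assoc[symmetric] inv_c' x)
    qed
    moreover have "(\<integral>\<^sup>+y. f x y \<partial>\<kappa> x) = (\<integral>\<^sup>+y. (SUP m. f x y * indicator (B m) y) \<partial>\<kappa> x)"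
    proof (rule nn_integral_cong)
      fix y
      assume "y \<in> space (\<kappa> x)"
      then obtain m where "y \<in> B m"
        using B(3) space[OF x] by auto
      then show "f x y = (SUP m. f x y * indicator (B m) y)"
        by (intro antisym SUP_upper2[of m] SUP_least) (auto simp: indicator_def)
    qed
    moreover have "\<dots> = (SUP m. \<integral>\<^sup>+y. f x y * indicator (B m) y \<partial>\<kappa> x)"
      using fx[OF x] B sets[OF x]
      by (intro nn_integral_monotone_convergence_SUP)
         (auto simp: incseq_def le_fun_def intro!: mult_left_mono split: split_indicator)
    ultimately show ?thesis
      by simp
  qed
  then show ?thesis
    by (subst measurable_cong) auto
qed

text \<open>Removing the countably many null overlaps makes the family disjoint without changing any of the measures.\<close>

lemma emeasure_UN_null_overlaps:
  assumes X: "\<And>i. i \<in> I \<Longrightarrow> X i \<in> sets M" and I: "countable I"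
    and null: "\<And>i j. i \<in> I \<Longrightarrow> j \<in> I \<Longrightarrow> i \<noteq> j \<Longrightarrow> emeasure M (X i \<inter> X j) = 0"
  shows "emeasure M (\<Union>i\<in>I. X i) = (\<integral>\<^sup>+i. emeasure M (X i) \<partial>count_space I)"
proof -
  define W where "W = (\<Union>(i, j)\<in>{p\<in>I \<times> I. fst p \<noteq> snd p}. X i \<inter> X j)"
  have cnt: "countable {p\<in>I \<times> I. fst p \<noteq> snd p}"
    using I by (auto intro: countable_subset[of _ "I \<times> I"])
  have W: "W \<in> null_sets M"
    unfolding W_def using cnt null X by (intro null_sets_UN') (auto intro!: null_setsI)
  have "emeasure M (\<Union>i\<in>I. X i) = emeasure M ((\<Union>i\<in>I. X i) - W)"
    using W X I by (intro emeasure_Diff_null_set[symmetric]) auto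
  also have "(\<Union>i\<in>I. X i) - W = (\<Union>i\<in>I. X i - W)"
    by auto
  also have "emeasure M \<dots> = (\<integral>\<^sup>+i. emeasure M (X i - W) \<partial>count_space I)"
  proof (rule emeasure_UN_countable[OF _ I])
    show "disjoint_family_on (\<lambda>i. X i - W) I"
      unfolding disjoint_family_on_def W_def by fastforce
  qed (use X W in auto)
  also have "\<dots> = (\<integral>\<^sup>+i. emeasure M (X i) \<partial>count_space I)"
    using X W by (intro nn_integral_cong emeasure_Diff_null_set) auto
  finally show ?thesis .
qed

text \<open>The counting measures on the sets \<open>S x\<close> form a kernel that is finite on the cylinders over balls. The
parameter \<open>x\<close> is not tied to the probability space, so that the lemma can be applied twice to get sums over
pairs of points.\<close>

lemma nn_integral_count_space_measurable:
  fixes S :: "'x \<Rightarrow> ('a::euclidean_space \<times> 'k::polish_space) set"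
  assumes fin: "\<And>x B. x \<in> space X \<Longrightarrow> bounded B \<Longrightarrow> finite (S x \<inter> B \<times> UNIV)"
    and count: "\<And>C. C \<in> sets borel \<Longrightarrow> (\<lambda>x. emeasure (count_space UNIV) (S x \<inter> C)) \<in> borel_measurable X"
    and f: "(\<lambda>(x, p). f x p) \<in> borel_measurable (X \<Otimes>\<^sub>M borel)"
  shows "(\<lambda>x. \<integral>\<^sup>+p. f x p \<partial>count_space (S x)) \<in> borel_measurable X"
proof -
  define \<kappa> where "\<kappa> x = distr (count_space (S x)) borel (\<lambda>p. p)" for x
  define B where "B m = cball (0::'a) (real m) \<times> (UNIV :: 'k set)" for m :: nat
  have \<kappa>: "emeasure (\<kappa> x) C = emeasure (count_space UNIV) (S x \<inter> C)" if "C \<in> sets borel" for x C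
    using that unfolding \<kappa>_def
    by (subst emeasure_distr) (auto simp: emeasure_count_space Int_commute)
  have B: "B m \<in> sets borel" "incseq B" "(\<Union>m. B m) = UNIV" for m
  proof -
    show "B m \<in> sets borel"
      unfolding B_def by (intro borel_closed closed_Times) auto
    show "incseq B"
      unfolding B_def incseq_def by auto
    have "\<exists>m. norm x \<le> real m" for x :: 'a
      by (rule real_arch_simple)
    then show "(\<Union>m. B m) = UNIV"
      by (auto simp: B_def)
  qed
  have "(\<lambda>x. \<integral>\<^sup>+p. f x p \<partial>\<kappa> x) \<in> borel_measurable X"
  proof (rule nn_integral_kernel_measurable[where N = borel and E = "sets borel" and B = B])
    show "sets borel = sigma_sets (space borel) (sets (borel :: ('a \<times> 'k) measure))"
      using sets.sigma_sets_eq[of "borel :: ('a \<times> 'k) measure"] by simp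
    show "Int_stable (sets (borel :: ('a \<times> 'k) measure))"
      by (auto simp: Int_stable_def)
    show "emeasure (\<kappa> x) (B m) < \<infinity>" if "x \<in> space X" for x m
      using fin[OF that, of "cball 0 (real m)"] B(1)[of m] by (simp add: \<kappa> B_def of_nat_less_top)
    show "(\<lambda>x. emeasure (\<kappa> x) (C \<inter> B m)) \<in> borel_measurable X" if "C \<in> insert (space borel) (sets borel)" for m C
      using that B(1)[of m] by (subst \<kappa>) (auto intro: count)
  qed (use B f in \<open>auto simp: \<kappa>_def\<close>)
  moreover have "(\<integral>\<^sup>+p. f x p \<partial>\<kappa> x) = (\<integral>\<^sup>+p. f x p \<partial>count_space (S x))" if "x \<in> space X" for x
    unfolding \<kappa>_def using measurable_Pair2[OF f that] by (subst nn_integral_distr) auto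
  ultimately show ?thesis
    by (subst measurable_cong[symmetric])
qed

lemma marked_point_process_integral_measurable:
  fixes \<Phi> :: "'w \<Rightarrow> ('a::euclidean_space \<times> 'k::polish_space) set"
  assumes "marked_point_process M \<Phi>" "f \<in> borel_measurable borel"
  shows "(\<lambda>\<omega>. \<integral>\<^sup>+p. f p \<partial>count_space (\<Phi> \<omega>)) \<in> borel_measurable M"
  using assms unfolding marked_point_process_def
  by (intro nn_integral_count_space_measurable) auto

text \<open>The second moment measure prescribes the expectation of a sum over pairs. To conclude that the sum vanishes
almost surely when its expectation does, the sum has to be a measurable function of the outcome.\<close>

lemma marked_point_process_pair_integral_measurable:
  fixes \<Phi> :: "'w \<Rightarrow> ('a::euclidean_space \<times> 'k::polish_space) set"
  assumes mpp: "marked_point_process M \<Phi>" and F: "F \<in> borel_measurable borel"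
  shows "(\<lambda>\<omega>. \<integral>\<^sup>+z. F z \<partial>count_space {(p, q). p \<in> \<Phi> \<omega> \<and> q \<in> \<Phi> \<omega> \<and> fst p \<noteq> fst q}) \<in> borel_measurable M"
proof -
  have fin: "finite (\<Phi> \<omega> \<inter> B \<times> UNIV)" if "\<omega> \<in> space M" "bounded B" for \<omega> B
    using mpp that by (auto simp: marked_point_process_def)
  have count: "(\<lambda>\<omega>. emeasure (count_space UNIV) (\<Phi> \<omega> \<inter> C)) \<in> borel_measurable M" if "C \<in> sets borel" for C
    using mpp that by (auto simp: marked_point_process_def)
  define D where "D = {z :: ('a \<times> 'k) \<times> ('a \<times> 'k). fst (fst z) \<noteq> fst (snd z)}"
  have "open D"
    unfolding D_def by (intro open_Collect_neq continuous_intros)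
  then have [measurable]: "D \<in> sets borel"
    by (rule borel_open)
  define G where "G z = F z * indicator D z" for z
  have "G \<in> borel_measurable borel"
    unfolding G_def using F by measurable
  then have G[measurable]: "G \<in> borel_measurable (borel \<Otimes>\<^sub>M borel)"
    by (simp add: borel_prod)
  have "(\<lambda>x. \<integral>\<^sup>+q. G (snd x, q) \<partial>count_space (\<Phi> (fst x))) \<in> borel_measurable (M \<Otimes>\<^sub>M (borel :: ('a \<times> 'k) measure))"
  proof (rule nn_integral_count_space_measurable)
    show "(\<lambda>x. emeasure (count_space UNIV) (\<Phi> (fst x) \<inter> C)) \<in> borel_measurable (M \<Otimes>\<^sub>M (borel :: ('a \<times> 'k) measure))"
      if "C \<in> sets borel" for C
      using count[OF that] by measurable
    show "(\<lambda>(x, q). G (snd x, q)) \<in> borel_measurable ((M \<Otimes>\<^sub>M borel) \<Otimes>\<^sub>M borel)"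
      by measurable
  qed (auto simp: space_pair_measure intro: fin)
  then have "(\<lambda>(\<omega>, p). \<integral>\<^sup>+q. G (p, q) \<partial>count_space (\<Phi> \<omega>)) \<in> borel_measurable (M \<Otimes>\<^sub>M borel)"
    by (simp add: case_prod_beta')
  then have "(\<lambda>\<omega>. \<integral>\<^sup>+p. \<integral>\<^sup>+q. G (p, q) \<partial>count_space (\<Phi> \<omega>) \<partial>count_space (\<Phi> \<omega>)) \<in> borel_measurable M"
    by (intro nn_integral_count_space_measurable fin count)
  moreover have "(\<integral>\<^sup>+p. \<integral>\<^sup>+q. G (p, q) \<partial>count_space (\<Phi> \<omega>) \<partial>count_space (\<Phi> \<omega>)) =
      (\<integral>\<^sup>+z. F z \<partial>count_space {(p, q). p \<in> \<Phi> \<omega> \<and> q \<in> \<Phi> \<omega> \<and> fst p \<noteq> fst q})" for \<omega>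
  proof -
    have "(\<integral>\<^sup>+p. \<integral>\<^sup>+q. G (p, q) \<partial>count_space (\<Phi> \<omega>) \<partial>count_space (\<Phi> \<omega>)) =
        (\<integral>\<^sup>+p. \<integral>\<^sup>+q. G (p, q) * indicator (\<Phi> \<omega>) q * indicator (\<Phi> \<omega>) p \<partial>count_space UNIV \<partial>count_space UNIV)"
      by (simp add: nn_integral_count_space_indicator nn_integral_multc)
    also have "\<dots> = (\<integral>\<^sup>+z. G z * indicator (\<Phi> \<omega>) (snd z) * indicator (\<Phi> \<omega>) (fst z) \<partial>count_space UNIV)"
      by (subst nn_integral_fst_count_space[symmetric]) simp
    also have "\<dots> = (\<integral>\<^sup>+z. F z * indicator {(p, q). p \<in> \<Phi> \<omega> \<and> q \<in> \<Phi> \<omega> \<and> fst p \<noteq> fst q} z \<partial>count_space UNIV)"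
      by (intro nn_integral_cong) (auto simp: G_def D_def split: split_indicator)
    finally show ?thesis
      by (simp add: nn_integral_count_space_indicator)
  qed
  ultimately show ?thesis
    by simp
qed

lemma campbell_formula:
  fixes \<Phi> :: "'w \<Rightarrow> ('a::euclidean_space \<times> 'k::polish_space) set"
  assumes mpp: "marked_point_process M \<Phi>" and int: "is_intensity_measure M \<Phi> \<Lambda>"
    and f: "f \<in> borel_measurable borel"
  shows "(\<integral>\<^sup>+p. f p \<partial>\<Lambda>) = (\<integral>\<^sup>+\<omega>. \<integral>\<^sup>+p. f p \<partial>count_space (\<Phi> \<omega>) \<partial>M)"
proof -
  have \<Lambda>[measurable_cong]: "sets \<Lambda> = sets borel"
    using int by (simp add: is_intensity_measure_def)
  note meas[measurable] = marked_point_process_integral_measurable[OF mpp]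
  show ?thesis
    using f
  proof induction
    case (cong f g)
    then have "f = g" by auto
    with cong show ?case by simp
  next
    case (set C)
    have "(\<integral>\<^sup>+p. indicator C p \<partial>count_space (\<Phi> \<omega>)) = emeasure (count_space UNIV) (\<Phi> \<omega> \<inter> C)" for \<omega>
      by (simp add: nn_integral_count_space_indicator nn_integral_indicator[symmetric] indicator_inter_arith mult.commute
        del: nn_integral_indicator)
    with set int show ?case
      by (simp add: is_intensity_measure_def \<Lambda>)
  next
    case (mult u c)
    then show ?case
      by (simp add: nn_integral_cmult)
  next
    case (add u v)
    then show ?case
      by (simp add: nn_integral_add)
  next
    case (seq U)
    have mono: "incseq (\<lambda>i. \<integral>\<^sup>+p. U i p \<partial>count_space (\<Phi> \<omega>))" for \<omega>
      using \<open>incseq U\<close> by (auto simp: incseq_def le_fun_def intro!: nn_integral_mono)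
    have "(\<integral>\<^sup>+p. (SUP i. U i p) \<partial>\<Lambda>) = (SUP i. \<integral>\<^sup>+p. U i p \<partial>\<Lambda>)"
      using seq by (intro nn_integral_monotone_convergence_SUP) auto
    also have "\<dots> = (SUP i. \<integral>\<^sup>+\<omega>. \<integral>\<^sup>+p. U i p \<partial>count_space (\<Phi> \<omega>) \<partial>M)"
      using seq by simp
    also have "\<dots> = (\<integral>\<^sup>+\<omega>. (SUP i. \<integral>\<^sup>+p. U i p \<partial>count_space (\<Phi> \<omega>)) \<partial>M)"
      using seq mono
      by (intro nn_integral_monotone_convergence_SUP[symmetric]) (auto simp: incseq_def le_fun_def)
    also have "\<dots> = (\<integral>\<^sup>+\<omega>. \<integral>\<^sup>+p. (SUP i. U i p) \<partial>count_space (\<Phi> \<omega>) \<partial>M)"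
      using seq by (simp add: nn_integral_monotone_convergence_SUP)
    finally show ?case
      by (simp add: image_comp)
  qed
qed

section \<open>The Hausdorff measures carried by the grains\<close>

lemma locally_finite_hausdorff_iff:
  fixes F :: "'a::euclidean_space set"
  assumes "closed F"
  shows "locally_finite_hausdorff n F \<longleftrightarrow>
    (\<forall>m::nat. hausdorff_outer n (F \<inter> cball 0 (real m)) < \<infinity>)"
proof
  assume "locally_finite_hausdorff n F"
  then show "\<forall>m::nat. hausdorff_outer n (F \<inter> cball 0 (real m)) < \<infinity>"
    using assms by (auto simp: locally_finite_hausdorff_def simp flip: emeasure_hausdorff_measure)
next
  assume fin: "\<forall>m::nat. hausdorff_outer n (F \<inter> cball 0 (real m)) < \<infinity>"
  show "locally_finite_hausdorff n F"
    unfolding locally_finite_hausdorff_def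
  proof (intro allI impI)
    fix K :: "'a set"
    assume K: "compact K"
    then obtain r where "\<forall>x\<in>K. norm x \<le> r"
      using compact_imp_bounded bounded_iff by metis
    moreover obtain m :: nat where "r \<le> real m"
      using real_arch_simple by blast
    ultimately have "F \<inter> K \<subseteq> F \<inter> cball 0 (real m)"
      by force
    then have "hausdorff_outer n (F \<inter> K) \<le> hausdorff_outer n (F \<inter> cball 0 (real m))"
      by (rule hausdorff_outer_mono)
    also have "\<dots> < \<infinity>"
      using fin by blast
    finally show "emeasure (hausdorff_measure n) (F \<inter> K) < \<infinity>"
      using assms K by (simp add: emeasure_hausdorff_measure compact_imp_closed)
  qed
qed

text \<open>Grains without locally finite \<open>\<H>\<^sup>n\<close>-measure are replaced by the empty set, so that \<open>grain_measure\<close> is a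
\<open>\<sigma>\<close>-finite kernel without exceptional marks.\<close>

locale grain_family =
  fixes n :: nat and Z :: "'k::second_countable_topology \<Rightarrow> 'a::euclidean_space set"
  assumes n_pos: "0 < n" and n_less: "n < DIM('a)"
    and Z_measurable: "Z \<in> borel \<rightarrow>\<^sub>M fell_borel"
begin

definition grain :: "'k \<Rightarrow> 'a set" where
  "grain s = (if locally_finite_hausdorff n (Z s) then Z s else {})"

definition grain_measure :: "'k \<Rightarrow> 'a measure" where
  "grain_measure s = density (hausdorff_measure n) (indicator (grain s))"

lemma closed_Z: "closed (Z s)"
  using measurable_space[OF Z_measurable, of s] by (simp add: space_fell_borel)

lemma closed_grain: "closed (grain s)"
  by (simp add: grain_def closed_Z)

lemma grain_borel [measurable]: "grain s \<in> sets borel"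
  by (intro borel_closed closed_grain)

lemma sets_grain_measure [measurable_cong, simp]: "sets (grain_measure s) = sets borel"
  by (simp add: grain_measure_def)

lemma space_grain_measure [simp]: "space (grain_measure s) = UNIV"
  by (simp add: grain_measure_def)

lemma emeasure_grain_measure:
  "A \<in> sets borel \<Longrightarrow> emeasure (grain_measure s) A = hausdorff_outer n (grain s \<inter> A)"
  by (simp add: grain_measure_def emeasure_restricted emeasure_hausdorff_measure)

lemma grain_cball_finite: "hausdorff_outer n (grain s \<inter> cball 0 (real m)) < \<infinity>"
  using closed_Z[of s] by (auto simp: grain_def locally_finite_hausdorff_iff hausdorff_outer_empty)

lemma sigma_finite_grain_measure: "sigma_finite_measure (grain_measure s)"
proof
  show "\<exists>A. countable A \<and> A \<subseteq> sets (grain_measure s) \<and> \<Union> A = space (grain_measure s) \<and>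
      (\<forall>a\<in>A. emeasure (grain_measure s) a \<noteq> \<infinity>)"
    using grain_cball_finite[of s]
    by (intro exI[of _ "range (\<lambda>m::nat. cball 0 (real m))"])
       (auto simp: UN_cball_nat emeasure_grain_measure less_top)
qed

lemma locally_finite_marks_measurable [measurable]:
  "{s. locally_finite_hausdorff n (Z s)} \<in> sets borel"
proof -
  have *: "(\<lambda>s. hausdorff_outer n (Z s \<inter> cball 0 (real m))) \<in> borel_measurable borel" for m :: nat
    using n_pos by (intro measurable_compose[OF Z_measurable] hausdorff_outer_compact_part_measurable) auto
  have "{s \<in> space borel. \<forall>m::nat. hausdorff_outer n (Z s \<inter> cball 0 (real m)) < \<infinity>} \<in> sets borel"
    using * by measurable
  then show ?thesis
    by (simp add: locally_finite_hausdorff_iff closed_Z)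
qed

lemma grain_graph_measurable: "{(s, u). u \<in> grain s} \<in> sets (borel \<Otimes>\<^sub>M borel)"
proof -
  have "{(s, u). s \<in> space borel \<and> u \<in> Z s} \<in> sets (borel \<Otimes>\<^sub>M borel)"
    by (rule graph_of_random_closed_set_measurable[OF Z_measurable])
  moreover have "{s. locally_finite_hausdorff n (Z s)} \<times> UNIV \<in> sets (borel \<Otimes>\<^sub>M (borel :: 'a measure))"
    by (intro pair_measureI) auto
  ultimately have "{(s, u). s \<in> space borel \<and> u \<in> Z s} \<inter> {s. locally_finite_hausdorff n (Z s)} \<times> UNIV
      \<in> sets (borel \<Otimes>\<^sub>M borel)"
    by (rule sets.Int)
  also have "{(s, u). s \<in> space borel \<and> u \<in> Z s} \<inter> {s. locally_finite_hausdorff n (Z s)} \<times> UNIV =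
      {(s, u). u \<in> grain s}"
    by (auto simp: grain_def split: if_splits)
  finally show ?thesis .
qed

text \<open>The closed sets generate the Borel sets and meet each ball in a compact set, so the measurability of
\<open>F \<mapsto> \<H>\<^sup>n(F \<inter> K)\<close> for compact \<open>K\<close> is what the kernel argument needs.\<close>

lemma grain_measure_integral_measurable:
  assumes t: "t \<in> borel_measurable X" and f: "(\<lambda>(x, u). f x u) \<in> borel_measurable (X \<Otimes>\<^sub>M borel)"
  shows "(\<lambda>x. \<integral>\<^sup>+u. f x u \<partial>grain_measure (t x)) \<in> borel_measurable X"
proof (rule nn_integral_kernel_measurable[where N = borel and E = "Collect closed" and B = "\<lambda>m. cball 0 (real m)"])
  show "sets borel = sigma_sets (space borel) (Collect closed :: 'a set set)"
    by (simp add: borel_eq_closed)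
  show "(\<lambda>x. emeasure (grain_measure (t x)) (C \<inter> cball 0 (real m))) \<in> borel_measurable X"
    if "C \<in> insert (space borel) (Collect closed)" for m :: nat and C
  proof -
    have C: "closed C"
      using that by auto
    have "(\<lambda>s. hausdorff_outer n (Z s \<inter> (C \<inter> cball 0 (real m)))) \<in> borel_measurable borel"
      using n_pos C
      by (intro measurable_compose[OF Z_measurable] hausdorff_outer_compact_part_measurable closed_Int_compact) auto
    then have "(\<lambda>s. if s \<in> {s. locally_finite_hausdorff n (Z s)}
        then hausdorff_outer n (Z s \<inter> (C \<inter> cball 0 (real m))) else 0) \<in> borel_measurable borel"
      by measurable
    also have "(\<lambda>s. if s \<in> {s. locally_finite_hausdorff n (Z s)}
        then hausdorff_outer n (Z s \<inter> (C \<inter> cball 0 (real m))) else 0) =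
      (\<lambda>s. emeasure (grain_measure s) (C \<inter> cball 0 (real m)))"
      using C by (auto simp: emeasure_grain_measure grain_def hausdorff_outer_empty fun_eq_iff)
    finally show ?thesis
      by (rule measurable_compose[OF t])
  qed
  show "emeasure (grain_measure (t x)) (cball 0 (real m)) < \<infinity>" for x and m :: nat
    using grain_cball_finite by (simp add: emeasure_grain_measure)
qed (use f in \<open>auto simp: Int_stable_def UN_cball_nat incseq_def\<close>)

lemma grain_volume_null: "emeasure hausdorff_volume (grain s) = 0"
proof -
  have "hausdorff_outer DIM('a) (grain s \<inter> cball 0 (real m)) = 0" for m
    using n_pos n_less grain_cball_finite by (intro hausdorff_outer_null_higher_order[of n]) auto
  then have "hausdorff_outer DIM('a) (\<Union>m::nat. grain s \<inter> cball 0 (real m)) \<le> 0"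
    using hausdorff_outer_UN[of "DIM('a)" "\<lambda>m. grain s \<inter> cball 0 (real m)"] by simp
  also have "(\<Union>m::nat. grain s \<inter> cball 0 (real m)) = grain s"
    using UN_cball_nat[where 'b = 'a] by auto
  finally show ?thesis
    by (simp add: emeasure_hausdorff_measure)
qed

lemma nn_integral_grain_measure:
  "f \<in> borel_measurable borel \<Longrightarrow>
    (\<integral>\<^sup>+u. f u \<partial>grain_measure s) = (\<integral>\<^sup>+u. indicator (grain s) u * f u \<partial>hausdorff_measure n)"
  unfolding grain_measure_def by (subst nn_integral_density) auto

lemma emeasure_translated_grain:
  assumes [measurable]: "A \<in> sets borel"
  shows "emeasure (hausdorff_measure n) ((+) x ` grain s \<inter> A) =
    (\<integral>\<^sup>+u. indicator A (x + u) \<partial>grain_measure s)"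
proof -
  have [measurable]: "(+) x ` grain s \<in> sets borel"
    by (intro translate_borel grain_borel)
  have "emeasure (hausdorff_measure n) ((+) x ` grain s \<inter> A) =
      (\<integral>\<^sup>+u. indicator ((+) x ` grain s \<inter> A) u \<partial>hausdorff_measure n)"
    by (subst nn_integral_indicator) auto
  also have "\<dots> = (\<integral>\<^sup>+u. indicator ((+) x ` grain s \<inter> A) (x + u) \<partial>hausdorff_measure n)"
    by (intro nn_integral_hausdorff_translation[symmetric]) auto
  also have "\<dots> = (\<integral>\<^sup>+u. indicator (grain s) u * indicator A (x + u) \<partial>hausdorff_measure n)"
    by (intro nn_integral_cong) (auto split: split_indicator)
  also have "\<dots> = (\<integral>\<^sup>+u. indicator A (x + u) \<partial>grain_measure s)"
    by (subst nn_integral_grain_measure) auto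
  finally show ?thesis .
qed

lemma grain_integral_reflected:
  assumes "f \<in> borel_measurable borel" "locally_finite_hausdorff n (Z s)"
  shows "(\<integral>\<^sup>+x\<in>(-) y ` Z s. f x \<partial>hausdorff_measure n) = (\<integral>\<^sup>+u. f (y - u) \<partial>grain_measure s)"
proof -
  have [measurable]: "f \<in> borel_measurable borel"
    by fact
  have "closed ((-) y -` Z s)"
    by (intro closed_vimage closed_Z continuous_intros)
  also have "(-) y -` Z s = (-) y ` Z s"
    by (force simp: image_iff)
  finally have "closed ((-) y ` Z s)" .
  then have [measurable]: "(-) y ` Z s \<in> sets borel"
    by (rule borel_closed)
  have "(\<integral>\<^sup>+x\<in>(-) y ` Z s. f x \<partial>hausdorff_measure n) =
      (\<integral>\<^sup>+u. f (y - u) * indicator ((-) y ` Z s) (y - u) \<partial>hausdorff_measure n)"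
    by (intro nn_integral_hausdorff_reflection[symmetric]) auto
  also have "\<dots> = (\<integral>\<^sup>+u. indicator (grain s) u * f (y - u) \<partial>hausdorff_measure n)"
    using assms(2) by (intro nn_integral_cong) (auto simp: grain_def split: split_indicator)
  also have "\<dots> = (\<integral>\<^sup>+u. f (y - u) \<partial>grain_measure s)"
    by (subst nn_integral_grain_measure) auto
  finally show ?thesis .
qed

section \<open>Overlaps and the density of the translated grains\<close>

text \<open>Overlaps are formed with the truncated grains, so that their mean over all positions is zero for every pair
of marks (\<open>overlap_integral_eq_0\<close>), including marks whose original grains are not locally finite.\<close>

definition overlap :: "('a \<times> 'k) \<times> ('a \<times> 'k) \<Rightarrow> ennreal" where
  "overlap = (\<lambda>((x, s), (y, t)). emeasure (hausdorff_measure n) ((+) x ` grain s \<inter> (+) y ` grain t))"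

text \<open>In this form the overlap is an integral of a jointly measurable function against \<open>grain_measure s\<close>, which
gives its measurability and access to Fubini.\<close>

lemma overlap_eq:
  "overlap ((x, s), (y, t)) = (\<integral>\<^sup>+u. indicator {(s, u). u \<in> grain s} (t, x + u - y) \<partial>grain_measure s)"
proof -
  have "overlap ((x, s), (y, t)) = (\<integral>\<^sup>+u. indicator ((+) y ` grain t) (x + u) \<partial>grain_measure s)"
    unfolding overlap_def by (simp add: emeasure_translated_grain translate_borel)
  also have "\<dots> = (\<integral>\<^sup>+u. indicator {(s, u). u \<in> grain s} (t, x + u - y) \<partial>grain_measure s)"
    by (intro nn_integral_cong) (force simp: image_iff algebra_simps split: split_indicator)
  finally show ?thesis .
qed

lemma overlap_measurable: "overlap \<in> borel_measurable borel"
proof -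
  note [measurable] = grain_graph_measurable
  have "(\<lambda>z. \<integral>\<^sup>+u. indicator {(s, u). u \<in> grain s} (snd (snd z), fst (fst z) + u - fst (snd z)) \<partial>grain_measure (snd (fst z)))
      \<in> borel_measurable (((borel :: 'a measure) \<Otimes>\<^sub>M (borel :: 'k measure)) \<Otimes>\<^sub>M (borel :: 'a measure) \<Otimes>\<^sub>M (borel :: 'k measure))"
    by (rule grain_measure_integral_measurable) measurable
  also have "(\<lambda>z. \<integral>\<^sup>+u. indicator {(s, u). u \<in> grain s} (snd (snd z), fst (fst z) + u - fst (snd z)) \<partial>grain_measure (snd (fst z))) = overlap"
    by (auto simp: fun_eq_iff overlap_eq)
  finally show ?thesis
    by (simp add: borel_prod)
qed

text \<open>After exchanging the integrals, the inner one is the volume of a reflected translate of \<open>grain t\<close>, which is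
null.\<close>

lemma overlap_integral_eq_0: "(\<integral>\<^sup>+y. overlap ((x, s), (y, t)) \<partial>hausdorff_volume) = 0"
proof -
  interpret V: sigma_finite_measure "hausdorff_volume :: 'a measure"
    by (rule sigma_finite_hausdorff_volume)
  interpret G: sigma_finite_measure "grain_measure s"
    by (rule sigma_finite_grain_measure)
  interpret P: pair_sigma_finite "grain_measure s" "hausdorff_volume :: 'a measure" ..
  have "(\<integral>\<^sup>+y. overlap ((x, s), (y, t)) \<partial>hausdorff_volume) =
      (\<integral>\<^sup>+y. \<integral>\<^sup>+u. indicator (grain t) (x + u - y) \<partial>grain_measure s \<partial>hausdorff_volume)"
    by (intro nn_integral_cong) (auto simp: overlap_eq intro!: nn_integral_cong split: split_indicator)
  also have "\<dots> = (\<integral>\<^sup>+u. \<integral>\<^sup>+y. indicator (grain t) (x + u - y) \<partial>hausdorff_volume \<partial>grain_measure s)"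
    by (rule P.Fubini') measurable
  also have "\<dots> = (\<integral>\<^sup>+u. \<integral>\<^sup>+y. indicator (grain t) y \<partial>hausdorff_volume \<partial>grain_measure s)"
    by (intro nn_integral_cong nn_integral_hausdorff_reflection) auto
  also have "\<dots> = 0"
    by (simp add: grain_volume_null)
  finally show ?thesis .
qed

definition expected_grain_density :: "('a \<times> 'k \<Rightarrow> ennreal) \<Rightarrow> 'k measure \<Rightarrow> 'a \<Rightarrow> ennreal" where
  "expected_grain_density h Q y = (\<integral>\<^sup>+s. \<integral>\<^sup>+u. h (y - u, s) \<partial>grain_measure s \<partial>Q)"

text \<open>Fubini is applied twice: for a fixed mark to exchange position and grain point, with the substitution
\<open>y = x + u\<close> in between, and then to bring the integral over the marks inside.\<close>

lemma expected_grain_density: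
  assumes h: "h \<in> borel_measurable borel" and Q: "sigma_finite_measure Q" "sets Q = sets borel"
  shows "expected_grain_density h Q \<in> borel_measurable borel"
    and "A \<in> sets borel \<Longrightarrow>
      (\<integral>\<^sup>+p. h p * (\<integral>\<^sup>+u. indicator A (fst p + u) \<partial>grain_measure (snd p)) \<partial>(hausdorff_volume \<Otimes>\<^sub>M Q)) =
      (\<integral>\<^sup>+y\<in>A. expected_grain_density h Q y \<partial>hausdorff_volume)"
proof -
  note [measurable_cong] = Q(2)
  interpret V: sigma_finite_measure "hausdorff_volume :: 'a measure"
    by (rule sigma_finite_hausdorff_volume)
  interpret Q: sigma_finite_measure Q
    by (rule Q(1))
  interpret VQ: pair_sigma_finite "hausdorff_volume :: 'a measure" Q ..
  have h'[measurable]: "h \<in> borel_measurable (borel \<Otimes>\<^sub>M borel)"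
    using h by (simp add: borel_prod)
  have inner[measurable]: "(\<lambda>(y, s). \<integral>\<^sup>+u. h (y - u, s) \<partial>grain_measure s) \<in> borel_measurable (borel \<Otimes>\<^sub>M borel)"
    unfolding case_prod_beta' by (rule grain_measure_integral_measurable) measurable
  show "expected_grain_density h Q \<in> borel_measurable borel"
    unfolding expected_grain_density_def by measurable
  assume A[measurable]: "A \<in> sets borel"
  have [measurable]: "(\<lambda>p. \<integral>\<^sup>+u. indicator A (fst p + u) \<partial>grain_measure (snd p))
      \<in> borel_measurable ((borel :: 'a measure) \<Otimes>\<^sub>M (borel :: 'k measure))"
    by (rule grain_measure_integral_measurable) measurable
  have mark: "(\<integral>\<^sup>+x. h (x, s) * (\<integral>\<^sup>+u. indicator A (x + u) \<partial>grain_measure s) \<partial>hausdorff_volume) =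
      (\<integral>\<^sup>+y. (\<integral>\<^sup>+u. h (y - u, s) \<partial>grain_measure s) * indicator A y \<partial>hausdorff_volume)" for s
  proof -
    interpret G: sigma_finite_measure "grain_measure s"
      by (rule sigma_finite_grain_measure)
    interpret P: pair_sigma_finite "grain_measure s" "hausdorff_volume :: 'a measure" ..
    have "(\<integral>\<^sup>+x. h (x, s) * (\<integral>\<^sup>+u. indicator A (x + u) \<partial>grain_measure s) \<partial>hausdorff_volume) =
        (\<integral>\<^sup>+x. \<integral>\<^sup>+u. h (x, s) * indicator A (x + u) \<partial>grain_measure s \<partial>hausdorff_volume)"
      by (intro nn_integral_cong nn_integral_cmult[symmetric]) measurable
    also have "\<dots> = (\<integral>\<^sup>+u. \<integral>\<^sup>+x. h (x, s) * indicator A (x + u) \<partial>hausdorff_volume \<partial>grain_measure s)"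
      by (rule P.Fubini') measurable
    also have "\<dots> = (\<integral>\<^sup>+u. \<integral>\<^sup>+y. h (y - u, s) * indicator A y \<partial>hausdorff_volume \<partial>grain_measure s)"
    proof (rule nn_integral_cong)
      fix u
      have "(\<integral>\<^sup>+y. h (- u + y, s) * indicator A ((- u + y) + u) \<partial>hausdorff_volume) =
          (\<integral>\<^sup>+x. h (x, s) * indicator A (x + u) \<partial>hausdorff_volume)"
        by (rule nn_integral_hausdorff_translation) auto
      then show "(\<integral>\<^sup>+x. h (x, s) * indicator A (x + u) \<partial>hausdorff_volume) =
          (\<integral>\<^sup>+y. h (y - u, s) * indicator A y \<partial>hausdorff_volume)"
        by simp
    qed
    also have "\<dots> = (\<integral>\<^sup>+y. \<integral>\<^sup>+u. h (y - u, s) * indicator A y \<partial>grain_measure s \<partial>hausdorff_volume)"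
      by (rule P.Fubini'[symmetric]) measurable
    also have "\<dots> = (\<integral>\<^sup>+y. (\<integral>\<^sup>+u. h (y - u, s) \<partial>grain_measure s) * indicator A y \<partial>hausdorff_volume)"
      by (intro nn_integral_cong nn_integral_multc) measurable
    finally show ?thesis .
  qed
  have "(\<integral>\<^sup>+p. h p * (\<integral>\<^sup>+u. indicator A (fst p + u) \<partial>grain_measure (snd p)) \<partial>(hausdorff_volume \<Otimes>\<^sub>M Q)) =
      (\<integral>\<^sup>+s. \<integral>\<^sup>+x. h (x, s) * (\<integral>\<^sup>+u. indicator A (x + u) \<partial>grain_measure s) \<partial>hausdorff_volume \<partial>Q)"
    by (subst VQ.nn_integral_snd[symmetric]) auto
  also have "\<dots> = (\<integral>\<^sup>+s. \<integral>\<^sup>+y. (\<integral>\<^sup>+u. h (y - u, s) \<partial>grain_measure s) * indicator A y \<partial>hausdorff_volume \<partial>Q)"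
    by (simp add: mark)
  also have "\<dots> = (\<integral>\<^sup>+y. \<integral>\<^sup>+s. (\<integral>\<^sup>+u. h (y - u, s) \<partial>grain_measure s) * indicator A y \<partial>Q \<partial>hausdorff_volume)"
    by (rule VQ.Fubini') measurable
  also have "\<dots> = (\<integral>\<^sup>+y\<in>A. expected_grain_density h Q y \<partial>hausdorff_volume)"
    unfolding expected_grain_density_def by (intro nn_integral_cong nn_integral_multc) measurable
  finally show "(\<integral>\<^sup>+p. h p * (\<integral>\<^sup>+u. indicator A (fst p + u) \<partial>grain_measure (snd p)) \<partial>(hausdorff_volume \<Otimes>\<^sub>M Q)) =
      (\<integral>\<^sup>+y\<in>A. expected_grain_density h Q y \<partial>hausdorff_volume)" .
qed

end

section \<open>The mean density of a germ-grain model\<close>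

theorem proposition5:
  fixes M :: "'w measure"
    and \<Theta> :: "'w \<Rightarrow> 'a::euclidean_space set"
    and \<Phi> :: "'w \<Rightarrow> ('a \<times> 'k::polish_space) set"
    and Z :: "'k \<Rightarrow> 'a set"
    and lam :: "'a \<times> 'k \<Rightarrow> real"
    and Q :: "'k measure"
    and g :: "('a \<times> 'k) \<times> ('a \<times> 'k) \<Rightarrow> real"
    and Q2 :: "('k \<times> 'k) measure"
    and n :: nat
  assumes n: "0 < n" "n < DIM('a)"
    and prob: "prob_space M"
    and random_closed: "\<Theta> \<in> M \<rightarrow>\<^sub>M fell_borel"
    and rectifiable: "AE \<omega> in M. countably_rectifiable n (\<Theta> \<omega>)"
    and dimension: "AE \<omega> in M. hausdorff_dim (\<Theta> \<omega>) = n"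
    and locally_finite: "AE \<omega> in M. locally_finite_hausdorff n (\<Theta> \<omega>)"
    and grains: "Z \<in> borel \<rightarrow>\<^sub>M fell_borel" "\<And>s. 0 \<in> Z s"
    and mpp: "marked_point_process M \<Phi>"
    and germ_grain: "AE \<omega> in M. \<Theta> \<omega> = (\<Union>(x, s)\<in>\<Phi> \<omega>. (+) x ` Z s)"
    and lam: "lam \<in> borel_measurable borel" "\<And>p. 0 \<le> lam p"
    and Q: "prob_space Q" "sets Q = sets borel"
    and intensity: "is_intensity_measure M \<Phi> (density (hausdorff_volume \<Otimes>\<^sub>M Q) (\<lambda>p. ennreal (lam p)))"
    and g: "g \<in> borel_measurable borel" "\<And>z. 0 \<le> g z"
    and Q2: "prob_space Q2" "sets Q2 = sets borel"
    and second_moment: "is_second_factorial_moment_measure M \<Phi>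
      (distr (density (hausdorff_volume \<Otimes>\<^sub>M hausdorff_volume \<Otimes>\<^sub>M Q2) (\<lambda>(x, y, s, t). ennreal (g ((x, s), (y, t)))))
        borel (\<lambda>(x, y, s, t). ((x, s), (y, t))))"
    and unused_marks: "AE s in Q. (AE x in hausdorff_volume. lam (x, s) = 0) \<longrightarrow> locally_finite_hausdorff n (Z s)"
  shows "(\<exists>l. is_mean_density M n \<Theta> l) \<and>
    (\<forall>l. is_mean_density M n \<Theta> l \<longrightarrow>
      (AE y in hausdorff_volume. l y = (\<integral>\<^sup>+s. (\<integral>\<^sup>+x\<in>(-) y ` Z s. ennreal (lam (x, s)) \<partial>hausdorff_measure n) \<partial>Q)))"
proof -
  interpret M: prob_space M by (rule prob)
  interpret Q: prob_space Q by (rule Q(1))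
  interpret Q2: prob_space Q2 by (rule Q2(1))
  interpret V: sigma_finite_measure "hausdorff_volume :: 'a measure"
    by (rule sigma_finite_hausdorff_volume)
  interpret VQ: pair_sigma_finite "hausdorff_volume :: 'a measure" Q ..
  interpret VQ2: pair_sigma_finite "hausdorff_volume :: 'a measure" Q2 ..
  interpret grain_family n Z
    by standard (use n grains in auto)
  note [measurable_cong] = Q(2) Q2(2)
  let ?H = "hausdorff_measure n :: 'a measure"
  define h where "h = (\<lambda>p. ennreal (lam p))"
  have h[measurable]: "h \<in> borel_measurable borel"
    unfolding h_def using lam(1) by measurable
  have h_prod[measurable]: "h \<in> borel_measurable (borel \<Otimes>\<^sub>M borel)"
    using h by (simp add: borel_prod)
  let ?\<Lambda> = "density (hausdorff_volume \<Otimes>\<^sub>M Q) h"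
  have intensity': "is_intensity_measure M \<Phi> ?\<Lambda>"
    using intensity unfolding h_def .

  have fin: "finite (\<Phi> \<omega> \<inter> B \<times> UNIV)" if "\<omega> \<in> space M" "bounded B" for \<omega> B
    using mpp that by (auto simp: marked_point_process_def)
  have inj: "AE \<omega> in M. inj_on fst (\<Phi> \<omega>)"
    using mpp by (simp add: marked_point_process_def)
  have countable: "countable (\<Phi> \<omega>)" if "\<omega> \<in> space M" for \<omega>
  proof -
    have "countable (\<Union>m::nat. \<Phi> \<omega> \<inter> cball 0 (real m) \<times> UNIV)"
      by (intro countable_UN[OF countableI_type] countable_finite fin[OF that] bounded_cball)
    also have "(\<Union>m::nat. \<Phi> \<omega> \<inter> cball 0 (real m) \<times> UNIV) = \<Phi> \<omega>"
      using UN_cball_nat[where 'b = 'a] by fastforce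
    finally show ?thesis .
  qed

  \<comment> \<open>Each grain of the process is, up to translation, a closed subset of \<open>\<Theta>\<close>, hence locally finite
    like \<open>\<Theta>\<close>.\<close>
  have marks: "AE \<omega> in M. \<forall>(x, s)\<in>\<Phi> \<omega>. locally_finite_hausdorff n (Z s)"
    using germ_grain locally_finite AE_space
  proof eventually_elim
    case (elim \<omega>)
    have closed: "closed (\<Theta> \<omega>)"
      using measurable_space[OF random_closed elim(3)] by (simp add: space_fell_borel)
    have "hausdorff_outer n (Z s \<inter> cball 0 (real m)) < \<infinity>" if "(x, s) \<in> \<Phi> \<omega>" for x s m
    proof -
      have "(+) x ` (Z s \<inter> cball 0 (real m)) \<subseteq> \<Theta> \<omega> \<inter> cball x (real m)"
        using elim(1) that by (force simp: dist_norm)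
      then have "hausdorff_outer n ((+) x ` (Z s \<inter> cball 0 (real m))) \<le> hausdorff_outer n (\<Theta> \<omega> \<inter> cball x (real m))"
        by (rule hausdorff_outer_mono)
      also have "\<dots> < \<infinity>"
        using elim(2) closed
        by (simp add: locally_finite_hausdorff_def flip: emeasure_hausdorff_measure)
      finally show ?thesis
        by (simp add: hausdorff_outer_translation)
    qed
    then show ?case
      by (auto simp: locally_finite_hausdorff_iff closed_Z)
  qed

  \<comment> \<open>The intensity measure does not charge the marks whose grain is not locally finite, so for
    almost every such mark \<open>lam\<close> vanishes at almost every position; these are the marks covered by the hypothesis \<open>unused_marks\<close>.\<close>
  have marks_Q: "AE s in Q. locally_finite_hausdorff n (Z s)"
  proof -
    define C where "C = (UNIV :: 'a set) \<times> {s. \<not> locally_finite_hausdorff n (Z s)}"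
    have "{s. \<not> locally_finite_hausdorff n (Z s)} \<in> sets borel"
      using sets.compl_sets[OF locally_finite_marks_measurable] by (simp add: Collect_neg_eq Compl_eq_Diff_UNIV)
    then have C_prod[measurable]: "C \<in> sets (borel \<Otimes>\<^sub>M borel)"
      unfolding C_def by (intro pair_measureI) auto
    then have "C \<in> sets borel"
      unfolding borel_prod .
    then have "emeasure ?\<Lambda> C = (\<integral>\<^sup>+\<omega>. emeasure (count_space UNIV) (\<Phi> \<omega> \<inter> C) \<partial>M)"
      using intensity' by (simp add: is_intensity_measure_def)
    also have "\<dots> = (\<integral>\<^sup>+\<omega>. 0 \<partial>M)"
    proof (rule nn_integral_cong_AE)
      show "AE \<omega> in M. emeasure (count_space UNIV) (\<Phi> \<omega> \<inter> C) = 0"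
        using marks
      proof eventually_elim
        case (elim \<omega>)
        then have "\<Phi> \<omega> \<inter> C = {}"
          by (auto simp: C_def)
        then show ?case by simp
      qed
    qed
    finally have "(\<integral>\<^sup>+p. h p * indicator C p \<partial>(hausdorff_volume \<Otimes>\<^sub>M Q)) = 0"
      by (subst (asm) emeasure_density) auto
    then have "(\<integral>\<^sup>+s. \<integral>\<^sup>+x. h (x, s) * indicator C (x, s) \<partial>hausdorff_volume \<partial>Q) = 0"
      by (subst VQ.nn_integral_snd) auto
    then have "AE s in Q. (\<integral>\<^sup>+x. h (x, s) * indicator C (x, s) \<partial>hausdorff_volume) = 0"
      by (subst (asm) nn_integral_0_iff_AE) auto
    then show ?thesis
      using unused_marks
    proof eventually_elim
      case (elim s)
      show ?case
      proof (rule ccontr)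
        assume bad: "\<not> ?thesis"
        with elim(1) have "(\<integral>\<^sup>+x. h (x, s) \<partial>hausdorff_volume) = 0"
          by (simp add: C_def)
        then have "AE x in hausdorff_volume. h (x, s) = 0"
          by (subst (asm) nn_integral_0_iff_AE) auto
        then have "AE x in hausdorff_volume. lam (x, s) = 0"
          by (rule AE_mp) (use lam(2) in \<open>auto simp: h_def ennreal_eq_0_iff intro!: AE_I2 antisym\<close>)
        with elim(2) bad show False
          by blast
      qed
    qed
  qed

  \<comment> \<open>Almost surely distinct points of the process have distinct positions, so the pairs with \<open>fst p \<noteq> fst q\<close> are all
    pairs of distinct points.\<close>
  have overlaps: "AE \<omega> in M. \<forall>p\<in>\<Phi> \<omega>. \<forall>q\<in>\<Phi> \<omega>. p \<noteq> q \<longrightarrow> overlap (p, q) = 0"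
  proof -
    let ?pairs = "\<lambda>\<omega>. {(p, q). p \<in> \<Phi> \<omega> \<and> q \<in> \<Phi> \<omega> \<and> fst p \<noteq> fst q}"
    let ?W = "(hausdorff_volume :: 'a measure) \<Otimes>\<^sub>M (hausdorff_volume :: 'a measure) \<Otimes>\<^sub>M Q2"
    \<comment> \<open>The reordering of coordinates under which the second factorial moment measure has density \<open>g\<close>.\<close>
    define T where "T = (\<lambda>(x :: 'a, y :: 'a, s :: 'k, t :: 'k). ((x, s), (y, t)))"
    define G where "G = (\<lambda>(x, y, s, t). ennreal (g ((x, s), (y, t))))"
    have G: "G = (\<lambda>w. ennreal (g (T w)))"
      by (auto simp: G_def T_def)
    have T_prod: "T \<in> borel \<Otimes>\<^sub>M borel \<Otimes>\<^sub>M borel \<Otimes>\<^sub>M borel \<rightarrow>\<^sub>M (borel \<Otimes>\<^sub>M borel) \<Otimes>\<^sub>M borel \<Otimes>\<^sub>M borel"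
      unfolding T_def by measurable
    have "sets Q2 = sets (borel \<Otimes>\<^sub>M borel)"
      unfolding borel_prod by (rule Q2(2))
    then have W: "sets ?W = sets (borel \<Otimes>\<^sub>M borel \<Otimes>\<^sub>M borel \<Otimes>\<^sub>M borel)"
      by (intro sets_pair_measure_cong sets_hausdorff_measure)
    have "T \<in> ?W \<rightarrow>\<^sub>M (borel \<Otimes>\<^sub>M borel) \<Otimes>\<^sub>M borel \<Otimes>\<^sub>M borel"
      unfolding measurable_cong_sets[OF W refl] by (rule T_prod)
    then have T[measurable]: "T \<in> ?W \<rightarrow>\<^sub>M borel"
      unfolding borel_prod .
    note [measurable] = overlap_measurable
    have G_meas[measurable]: "G \<in> borel_measurable ?W"
      unfolding G using g(1) by measurable
    have null: "(\<integral>\<^sup>+w. overlap (T w) \<partial>?W) = 0"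
    proof -
      have inner: "(\<integral>\<^sup>+y. overlap (T (x, y, r)) \<partial>hausdorff_volume) = 0" for x r
        by (cases r) (simp add: T_def overlap_integral_eq_0)
      have "(\<integral>\<^sup>+w. overlap (T w) \<partial>?W) =
          (\<integral>\<^sup>+x. \<integral>\<^sup>+(y, r). overlap (T (x, y, r)) \<partial>(hausdorff_volume \<Otimes>\<^sub>M Q2) \<partial>hausdorff_volume)"
        by (subst VQ2.nn_integral_fst[symmetric]) (auto simp: case_prod_beta')
      also have "\<dots> = (\<integral>\<^sup>+x. \<integral>\<^sup>+r. \<integral>\<^sup>+y. overlap (T (x, y, r)) \<partial>hausdorff_volume \<partial>Q2 \<partial>hausdorff_volume)"
        by (intro nn_integral_cong) (subst VQ2.nn_integral_snd[symmetric], auto)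
      also have "\<dots> = 0"
        by (simp add: inner)
      finally show ?thesis .
    qed
    have "(\<integral>\<^sup>+\<omega>. \<integral>\<^sup>+z. overlap z \<partial>count_space (?pairs \<omega>) \<partial>M) = (\<integral>\<^sup>+z. overlap z \<partial>distr (density ?W G) borel T)"
      using second_moment unfolding is_second_factorial_moment_measure_def G_def T_def
      by (auto simp: overlap_measurable)
    also have "\<dots> = (\<integral>\<^sup>+w. G w * overlap (T w) \<partial>?W)"
      by (subst nn_integral_distr) (auto simp: nn_integral_density)
    also have "\<dots> = (\<integral>\<^sup>+w. 0 \<partial>?W)"
    proof (rule nn_integral_cong_AE)
      have "AE w in ?W. overlap (T w) = 0"
        using null by (subst (asm) nn_integral_0_iff_AE) auto
      then show "AE w in ?W. G w * overlap (T w) = 0"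
        by eventually_elim simp
    qed
    finally have "(\<integral>\<^sup>+\<omega>. \<integral>\<^sup>+z. overlap z \<partial>count_space (?pairs \<omega>) \<partial>M) = 0"
      by simp
    then have "AE \<omega> in M. (\<integral>\<^sup>+z. overlap z \<partial>count_space (?pairs \<omega>)) = 0"
      using marked_point_process_pair_integral_measurable[OF mpp overlap_measurable]
      by (subst (asm) nn_integral_0_iff_AE) auto
    then show ?thesis
      using inj
    proof eventually_elim
      case (elim \<omega>)
      have "\<forall>z\<in>?pairs \<omega>. overlap z = 0"
        using elim(1) by (subst (asm) nn_integral_0_iff_AE) (auto simp: AE_count_space)
      with elim(2) show ?case
        unfolding inj_on_def by blast
    qed
  qed

  have sum_of_grains: "AE \<omega> in M. emeasure ?H (\<Theta> \<omega> \<inter> A) =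
      (\<integral>\<^sup>+p. (\<integral>\<^sup>+u. indicator A (fst p + u) \<partial>grain_measure (snd p)) \<partial>count_space (\<Phi> \<omega>))"
    if A: "A \<in> sets borel" for A
    using germ_grain marks overlaps AE_space
  proof eventually_elim
    case (elim \<omega>)
    define X where "X p = (+) (fst p) ` grain (snd p)" for p :: "'a \<times> 'k"
    have X[measurable]: "X p \<in> sets borel" for p
      unfolding X_def by (intro translate_borel grain_borel)
    have "X p = (+) (fst p) ` Z (snd p)" if "p \<in> \<Phi> \<omega>" for p
      using elim(2) that by (cases p) (auto simp: X_def grain_def)
    then have "\<Theta> \<omega> = (\<Union>p\<in>\<Phi> \<omega>. X p)"
      using elim(1) by (simp add: case_prod_beta' cong: SUP_cong)
    then have "\<Theta> \<omega> \<inter> A = (\<Union>p\<in>\<Phi> \<omega>. X p \<inter> A)"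
      by simp
    also have "emeasure ?H \<dots> = (\<integral>\<^sup>+p. emeasure ?H (X p \<inter> A) \<partial>count_space (\<Phi> \<omega>))"
    proof (rule emeasure_UN_null_overlaps)
      fix p q
      assume "p \<in> \<Phi> \<omega>" "q \<in> \<Phi> \<omega>" "p \<noteq> q"
      then have "overlap (p, q) = 0"
        using elim(3) by blast
      then have "emeasure ?H (X p \<inter> X q) = 0"
        by (simp add: overlap_def X_def case_prod_beta)
      moreover have "emeasure ?H (X p \<inter> A \<inter> (X q \<inter> A)) \<le> emeasure ?H (X p \<inter> X q)"
        by (intro emeasure_mono) auto
      ultimately show "emeasure ?H (X p \<inter> A \<inter> (X q \<inter> A)) = 0"
        by simp
    qed (use A countable[OF elim(4)] in auto)
    finally show ?case
      using A by (simp add: X_def emeasure_translated_grain)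
  qed

  define l where "l = expected_grain_density h Q"
  have l: "l \<in> borel_measurable borel"
    unfolding l_def by (rule expected_grain_density(1)[OF h _ Q(2)]) unfold_locales
  have mean: "(\<integral>\<^sup>+\<omega>. emeasure ?H (\<Theta> \<omega> \<inter> A) \<partial>M) = (\<integral>\<^sup>+y\<in>A. l y \<partial>hausdorff_volume)"
    if A[measurable]: "A \<in> sets borel" for A
  proof -
    let ?f = "\<lambda>p. \<integral>\<^sup>+u. indicator A (fst p + u) \<partial>grain_measure (snd p)"
    have f_prod[measurable]: "?f \<in> borel_measurable ((borel :: 'a measure) \<Otimes>\<^sub>M (borel :: 'k measure))"
      by (rule grain_measure_integral_measurable) measurable
    then have f: "?f \<in> borel_measurable borel"
      unfolding borel_prod .
    have "(\<integral>\<^sup>+\<omega>. emeasure ?H (\<Theta> \<omega> \<inter> A) \<partial>M) = (\<integral>\<^sup>+\<omega>. \<integral>\<^sup>+p. ?f p \<partial>count_space (\<Phi> \<omega>) \<partial>M)"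
      by (rule nn_integral_cong_AE[OF sum_of_grains[OF A]])
    also have "\<dots> = (\<integral>\<^sup>+p. ?f p \<partial>?\<Lambda>)"
      by (rule campbell_formula[OF mpp intensity' f, symmetric])
    also have "\<dots> = (\<integral>\<^sup>+p. h p * ?f p \<partial>(hausdorff_volume \<Otimes>\<^sub>M Q))"
      by (rule nn_integral_density) measurable
    also have "\<dots> = (\<integral>\<^sup>+y\<in>A. l y \<partial>hausdorff_volume)"
      unfolding l_def by (rule expected_grain_density(2)[OF h _ Q(2) A]) unfold_locales
    finally show ?thesis .
  qed

  \<comment> \<open>This holds at every \<open>y\<close>, since the exceptional set of marks does not depend on \<open>y\<close>.\<close>
  have formula: "l y = (\<integral>\<^sup>+s. (\<integral>\<^sup>+x\<in>(-) y ` Z s. ennreal (lam (x, s)) \<partial>?H) \<partial>Q)" for y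
    unfolding l_def expected_grain_density_def
  proof (rule nn_integral_cong_AE)
    show "AE s in Q. (\<integral>\<^sup>+u. h (y - u, s) \<partial>grain_measure s) = (\<integral>\<^sup>+x\<in>(-) y ` Z s. ennreal (lam (x, s)) \<partial>?H)"
      using marks_Q
    proof eventually_elim
      case (elim s)
      have "(\<integral>\<^sup>+x\<in>(-) y ` Z s. h (x, s) \<partial>?H) = (\<integral>\<^sup>+u. h (y - u, s) \<partial>grain_measure s)"
        by (rule grain_integral_reflected[OF _ elim]) measurable
      then show ?case
        by (simp add: h_def)
    qed
  qed

  show ?thesis
  proof (intro conjI allI impI)
    show "\<exists>l. is_mean_density M n \<Theta> l"
      using l mean by (auto simp: is_mean_density_def)
    fix l'
    assume "is_mean_density M n \<Theta> l'"
    then have l'_measurable: "l' \<in> borel_measurable borel"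
      and l'_integral: "\<And>A. A \<in> sets borel \<Longrightarrow>
        (\<integral>\<^sup>+y\<in>A. l' y \<partial>hausdorff_volume) = (\<integral>\<^sup>+y\<in>A. l y \<partial>hausdorff_volume)"
      using mean by (simp_all add: is_mean_density_def)
    have "density hausdorff_volume l' = density hausdorff_volume l"
    proof (rule measure_eqI)
      fix A
      assume "A \<in> sets (density (hausdorff_volume :: 'a measure) l')"
      then have "A \<in> sets borel"
        by simp
      then show "emeasure (density hausdorff_volume l') A = emeasure (density hausdorff_volume l) A"
        using l l'_measurable l'_integral by (simp add: emeasure_density)
    qed simp
    then have "AE y in hausdorff_volume. l' y = l y"
      using l l'_measurable by (intro V.density_unique) auto
    then show "AE y in hausdorff_volume. l' y = (\<integral>\<^sup>+s. (\<integral>\<^sup>+x\<in>(-) y ` Z s. ennreal (lam (x, s)) \<partial>?H) \<partial>Q)"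
      by eventually_elim (simp add: formula)
  qed
qed

end
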